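(* Let $(f,g):\mathcal{C}(1)\to\mathcal{C}(2)$ be a morphism of exact couples of $R$-modules such that for $s\in\{1,2\}$: (1) the associated spectral sequences satisfy $E^r_{p,q}(s)=0$ for all $r\geq 2$ whenever $p<0$ or $q<0$; (2) for $r\geq 2$ the differential $d^r(s)$ on $E^r(s)$ has bidegree $(-r,r-1)$; (3) the $E^\infty$-objects match the colimit abutment: $L_n(s)=0$ for $n<0$ and, for each $n\geq 0$, the canonical filtration of $L_n(s)$ has the form $$0=F_{-1,n+1}(s)\subseteq F_{0,n}(s)\subseteq\cdots\subseteq F_{n,0}(s)=L_n(s),$$ with short exact sequences $0\to F_{p-1,q+1}(s)\to F_{p,q}(s)\to E^\infty_{p,q}(s)\to 0$ for $p+q=n$, compatible with the maps induced by $(f,g)$. Assume further: (i) The induced map of colimit abutment objects $L_n(f):L_n(1)\to L_n(2)$ is an isomorphism for all $n\in\mathbb{Z}$. (ii) $f^2_{0,0}:E^2_{0,0}(1)\to E^2_{0,0}(2)$ is an isomorphism. (iii) For every $n\geq 0$: if $f^2_{0,q}:E^2_{0,q}(1)\to E^2_{0,q}(2)$ is an isomorphism for $0\leq q\leq n$, then $f^2_{p,q}$ is an isomorphism for all $(p,q)$ with $q\leq n$ and all $p\in\mathbb{Z}$. Then the induced map $(f^r\mid r\geq 2)$ of spectral sequences is an isomorphism.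
   Context: $R$ is a unital ring. A $(\mathbb{Z}\times\mathbb{Z})$-bigraded exact couple $(E,D,i,j,k)$ with bidegrees $\mathbf{a},\mathbf{b},\mathbf{c}\in\mathbb{Z}\times\mathbb{Z}$ consists of families of $R$-modules $D_{\mathbf{x}},E_{\mathbf{x}}$ ($\mathbf{x}\in\mathbb{Z}\times\mathbb{Z}$) and $R$-linear maps $i_{\mathbf{x}}:D_{\mathbf{x}}\to D_{\mathbf{x}+\mathbf{a}}$, $j_{\mathbf{x}}:D_{\mathbf{x}}\to E_{\mathbf{x}+\mathbf{b}}$, $k_{\mathbf{x}}:E_{\mathbf{x}}\to D_{\mathbf{x}+\mathbf{c}}$ such that $D_{\mathbf{x}-\mathbf{a}}\xrightarrow{i}D_{\mathbf{x}}\xrightarrow{j}E_{\mathbf{x}+\mathbf{b}}\xrightarrow{k}D_{\mathbf{x}+\mathbf{b}+\mathbf{c}}\xrightarrow{i}D_{\mathbf{x}+\mathbf{a}+\mathbf{b}+\mathbf{c}}$ is exact for all $\mathbf{x}$. A morphism $(f,g)$ of exact couples with equal bidegrees is a pair of families $f_{\mathbf{x}}:D_{\mathbf{x}}(1)\to D_{\mathbf{x}}(2)$, $g_{\mathbf{x}}:E_{\mathbf{x}}(1)\to E_{\mathbf{x}}(2)$ commuting with $i,j,k$. Associated spectral sequence: with $i^r$ the $r$-fold composite of $i$, put $Z^{r}_{\mathbf{x}+\mathbf{b}}=k^{-1}(\operatorname{im}\,i^{r}_{\mathbf{x}+\mathbf{b}+\mathbf{c}-r\mathbf{a}})$, $B^r_{\mathbf{x}+\mathbf{b}}=j(\ker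 i^r_{\mathbf{x}})$, $E^{r+1}=Z^r/B^r$ for $r\ge 0$; $d^r$ on $E^r$ sends the class of $e$ to the class of $j(y)$ where $i^{r-1}(y)=k(e)$; it has bidegree $\mathbf{b}+\mathbf{c}-(r-1)\mathbf{a}$, and $E^{r+1}$ is the homology of $(E^r,d^r)$. $E^\infty:=\bigcap_rZ^r/\bigcup_rB^r$. A morphism of exact couples induces a morphism $f^r:E^r(1)\to E^r(2)$ of spectral sequences ($r\leq\infty$). Condition (2) forces $\mathbf{a}=(1,-1)$ and $\mathbf{b}+\mathbf{c}=(-1,0)$. The colimit abutment $L_n$ is the colimit of the diagram $\cdots\to D_{\mathbf{x}-\mathbf{a}}\xrightarrow{i}D_{\mathbf{x}}\xrightarrow{i}D_{\mathbf{x}+\mathbf{a}}\to\cdots$ of all $D_{\mathbf{x}}$ with $\det[\mathbf{a}\ \mathbf{x}]=n$, i.e. $\mathbf{x}=(p,q)$ with $p+q=n$; its canonical filtration is by the images of the cocone maps $D_{\mathbf{x}}\to L_n$. A morphism of exact couples induces filtration-preserving maps $L_n(f):L_n(1)\to L_n(2)$. *)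

theory Defs
  imports "HOL-Algebra.Module" "HOL-Algebra.AbelCoset" "HOL-Library.Product_Plus"
begin

section \<open>Modules over a unital, not necessarily commutative, ring\<close>

text \<open>The library locale \<open>module\<close> requires a commutative ring of scalars; the following is the
  same list of axioms over an arbitrary ring.\<close>

locale left_module = R?: ring R + M?: abelian_group M for R (structure) and M (structure) +
  assumes smult_closed [simp, intro]:
      "\<lbrakk>r \<in> carrier R; x \<in> carrier M\<rbrakk> \<Longrightarrow> r \<odot>\<^bsub>M\<^esub> x \<in> carrier M"
    and smult_l_distr:
      "\<lbrakk>r \<in> carrier R; s \<in> carrier R; x \<in> carrier M\<rbrakk> \<Longrightarrow>
        (r \<oplus>\<^bsub>R\<^esub> s) \<odot>\<^bsub>M\<^esub> x = r \<odot>\<^bsub>M\<^esub> x \<oplus>\<^bsub>M\<^esub> s \<odot>\<^bsub>M\<^esub> x"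
    and smult_r_distr:
      "\<lbrakk>r \<in> carrier R; x \<in> carrier M; y \<in> carrier M\<rbrakk> \<Longrightarrow>
        r \<odot>\<^bsub>M\<^esub> (x \<oplus>\<^bsub>M\<^esub> y) = r \<odot>\<^bsub>M\<^esub> x \<oplus>\<^bsub>M\<^esub> r \<odot>\<^bsub>M\<^esub> y"
    and smult_assoc1:
      "\<lbrakk>r \<in> carrier R; s \<in> carrier R; x \<in> carrier M\<rbrakk> \<Longrightarrow>
        (r \<otimes>\<^bsub>R\<^esub> s) \<odot>\<^bsub>M\<^esub> x = r \<odot>\<^bsub>M\<^esub> (s \<odot>\<^bsub>M\<^esub> x)"
    and smult_one [simp]:
      "x \<in> carrier M \<Longrightarrow> \<one>\<^bsub>R\<^esub> \<odot>\<^bsub>M\<^esub> x = x"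

definition lin_hom ::
  "('r, 'q) ring_scheme \<Rightarrow> ('r, 'm) module \<Rightarrow> ('r, 'n) module \<Rightarrow> ('m \<Rightarrow> 'n) set" where
  "lin_hom R M N = {h. h \<in> carrier M \<rightarrow> carrier N \<and>
     (\<forall>x\<in>carrier M. \<forall>y\<in>carrier M. h (x \<oplus>\<^bsub>M\<^esub> y) = h x \<oplus>\<^bsub>N\<^esub> h y) \<and>
     (\<forall>r\<in>carrier R. \<forall>x\<in>carrier M. h (r \<odot>\<^bsub>M\<^esub> x) = r \<odot>\<^bsub>N\<^esub> h x)}"

definition lin_iso ::
  "('r, 'q) ring_scheme \<Rightarrow> ('r, 'm) module \<Rightarrow> ('r, 'n) module \<Rightarrow> ('m \<Rightarrow> 'n) set" where
  "lin_iso R M N = {h \<in> lin_hom R M N. bij_betw h (carrier M) (carrier N)}"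

definition zero_module :: "('r, 'm) module \<Rightarrow> bool" where
  "zero_module M \<longleftrightarrow> carrier M = {\<zero>\<^bsub>M\<^esub>}"

text \<open>The subquotient \<open>Z/B\<close> of \<open>M\<close>, for submodules \<open>B \<subseteq> Z\<close> of \<open>M\<close>. The ring fields \<open>mult\<close> and
  \<open>one\<close> inherited by the record type \<open>module\<close> play no role for modules.\<close>

definition quot_module :: "('r, 'm) module \<Rightarrow> 'm set \<Rightarrow> 'm set \<Rightarrow> ('r, 'm set) module" where
  "quot_module M Z B =
    \<lparr>carrier = (\<lambda>z. B +>\<^bsub>M\<^esub> z) ` Z, mult = undefined, one = undefined,
     zero = B, add = (\<lambda>U V. U <+>\<^bsub>M\<^esub> V), smult = (\<lambda>r U. \<Union>u\<in>U. B +>\<^bsub>M\<^esub> (r \<odot>\<^bsub>M\<^esub> u))\<rparr>"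

text \<open>The map into a quotient of \<open>N\<close> by \<open>B\<close> induced by \<open>h\<close>: it sends the class of \<open>u\<close> to the class
  of \<open>h u\<close> (the union below is over equal sets whenever \<open>h\<close> descends to the quotients).\<close>

definition quot_map :: "('r, 'n) module \<Rightarrow> 'n set \<Rightarrow> ('m \<Rightarrow> 'n) \<Rightarrow> 'm set \<Rightarrow> 'n set" where
  "quot_map N B h U = (\<Union>u\<in>U. B +>\<^bsub>N\<^esub> h u)"


section \<open>Bigraded exact couples\<close>

definition zscale :: "int \<Rightarrow> int \<times> int \<Rightarrow> int \<times> int" where
  "zscale n v = (n * fst v, n * snd v)"

record ('r, 'd, 'e) couple =
  Dmod :: "int \<times> int \<Rightarrow> ('r, 'd) module"
  Emod :: "int \<times> int \<Rightarrow> ('r, 'e) module"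
  imap :: "int \<times> int \<Rightarrow> 'd \<Rightarrow> 'd"
  jmap :: "int \<times> int \<Rightarrow> 'd \<Rightarrow> 'e"
  kmap :: "int \<times> int \<Rightarrow> 'e \<Rightarrow> 'd"
  dega :: "int \<times> int"
  degb :: "int \<times> int"
  degc :: "int \<times> int"

locale exact_couple = ring R for R (structure) and C :: "('a, 'd, 'e) couple" +
  assumes D_module: "\<And>x. left_module R (Dmod C x)"
    and E_module: "\<And>x. left_module R (Emod C x)"
    and i_lin: "\<And>x. imap C x \<in> lin_hom R (Dmod C x) (Dmod C (x + dega C))"
    and j_lin: "\<And>x. jmap C x \<in> lin_hom R (Dmod C x) (Emod C (x + degb C))"
    and k_lin: "\<And>x. kmap C x \<in> lin_hom R (Emod C x) (Dmod C (x + degc C))"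
    and exact_ij: "\<And>x. imap C (x - dega C) ` carrier (Dmod C (x - dega C)) =
       a_kernel (Dmod C x) (Emod C (x + degb C)) (jmap C x)"
    and exact_jk: "\<And>x. jmap C x ` carrier (Dmod C x) =
       a_kernel (Emod C (x + degb C)) (Dmod C (x + degb C + degc C)) (kmap C (x + degb C))"
    and exact_ki: "\<And>x. kmap C (x + degb C) ` carrier (Emod C (x + degb C)) =
       a_kernel (Dmod C (x + degb C + degc C)) (Dmod C (x + dega C + degb C + degc C))
         (imap C (x + degb C + degc C))"

definition couple_morphism :: "('r, 'q) ring_scheme \<Rightarrow> ('r, 'd1, 'e1) couple \<Rightarrow> ('r, 'd2, 'e2) couple
    \<Rightarrow> (int \<times> int \<Rightarrow> 'd1 \<Rightarrow> 'd2) \<Rightarrow> (int \<times> int \<Rightarrow> 'e1 \<Rightarrow> 'e2) \<Rightarrow> bool" where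
  "couple_morphism R C1 C2 f g \<longleftrightarrow>
     dega C1 = dega C2 \<and> degb C1 = degb C2 \<and> degc C1 = degc C2 \<and>
     (\<forall>x. f x \<in> lin_hom R (Dmod C1 x) (Dmod C2 x)) \<and>
     (\<forall>x. g x \<in> lin_hom R (Emod C1 x) (Emod C2 x)) \<and>
     (\<forall>x. \<forall>y\<in>carrier (Dmod C1 x). f (x + dega C1) (imap C1 x y) = imap C2 x (f x y)) \<and>
     (\<forall>x. \<forall>y\<in>carrier (Dmod C1 x). g (x + degb C1) (jmap C1 x y) = jmap C2 x (f x y)) \<and>
     (\<forall>x. \<forall>e\<in>carrier (Emod C1 x). f (x + degc C1) (kmap C1 x e) = kmap C2 x (g x e))"


section \<open>The associated spectral sequence\<close>

text \<open>\<open>ipow C r x\<close> is the \<open>r\<close>-fold composite of \<open>i\<close> from \<open>D\<close> at \<open>x\<close> to \<open>D\<close> at \<open>x + r a\<close>.\<close>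

primrec ipow :: "('r, 'd, 'e) couple \<Rightarrow> nat \<Rightarrow> int \<times> int \<Rightarrow> 'd \<Rightarrow> 'd" where
  "ipow C 0 x y = y"
| "ipow C (Suc r) x y = imap C (x + zscale (int r) (dega C)) (ipow C r x y)"

text \<open>\<open>Zsub\<close> and \<open>Bsub\<close> are indexed by the position \<open>x\<close> of \<open>E\<close> in which they lie.\<close>

definition Zsub :: "('r, 'd, 'e) couple \<Rightarrow> nat \<Rightarrow> int \<times> int \<Rightarrow> 'e set" where
  "Zsub C r x = (let w = x + degc C - zscale (int r) (dega C) in
     {e \<in> carrier (Emod C x). kmap C x e \<in> ipow C r w ` carrier (Dmod C w)})"

definition Bsub :: "('r, 'd, 'e) couple \<Rightarrow> nat \<Rightarrow> int \<times> int \<Rightarrow> 'e set" where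
  "Bsub C r x = (let w = x - degb C in
     jmap C w ` a_kernel (Dmod C w) (Dmod C (w + zscale (int r) (dega C))) (ipow C r w))"

text \<open>\<open>page C r\<close> is \<open>E\<^sup>r = Z\<^sup>r\<^sup>-\<^sup>1/B\<^sup>r\<^sup>-\<^sup>1\<close>, which is meaningful only for \<open>r \<ge> 1\<close>; the same restriction applies to
  the differentials and induced maps below.\<close>

definition page :: "('r, 'd, 'e) couple \<Rightarrow> nat \<Rightarrow> int \<times> int \<Rightarrow> ('r, 'e set) module" where
  "page C r x = quot_module (Emod C x) (Zsub C (r - 1) x) (Bsub C (r - 1) x)"

definition page_inf :: "('r, 'd, 'e) couple \<Rightarrow> int \<times> int \<Rightarrow> ('r, 'e set) module" where
  "page_inf C x = quot_module (Emod C x) (\<Inter>r. Zsub C r x) (\<Union>r. Bsub C r x)"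

definition diff_deg :: "('r, 'd, 'e) couple \<Rightarrow> nat \<Rightarrow> int \<times> int" where
  "diff_deg C r = degb C + degc C - zscale (int r - 1) (dega C)"

text \<open>The differential sends the class of \<open>e\<close> to the class of \<open>j y\<close> where \<open>i\<^sup>r\<^sup>-\<^sup>1 y = k e\<close>; this class
  does not depend on the choice of \<open>e\<close> and \<open>y\<close>, so that the union is over equal sets.\<close>

definition page_diff :: "('r, 'd, 'e) couple \<Rightarrow> nat \<Rightarrow> int \<times> int \<Rightarrow> 'e set \<Rightarrow> 'e set" where
  "page_diff C r x U = (let w = x + degc C - zscale (int r - 1) (dega C); t = x + diff_deg C r in
     (\<Union>e\<in>U. \<Union>y\<in>{y \<in> carrier (Dmod C w). ipow C (r - 1) w y = kmap C x e}.
        Bsub C (r - 1) t +>\<^bsub>Emod C t\<^esub> jmap C w y))"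

definition page_boundaries :: "('r, 'd, 'e) couple \<Rightarrow> nat \<Rightarrow> int \<times> int \<Rightarrow> 'e set set" where
  "page_boundaries C r x =
     page_diff C r (x - diff_deg C r) ` carrier (page C r (x - diff_deg C r))"

definition page_homology ::
  "('r, 'd, 'e) couple \<Rightarrow> nat \<Rightarrow> int \<times> int \<Rightarrow> ('r, 'e set set) module" where
  "page_homology C r x = quot_module (page C r x)
     (a_kernel (page C r x) (page C r (x + diff_deg C r)) (page_diff C r x)) (page_boundaries C r x)"

definition page_map :: "('r, 'd1, 'e1) couple \<Rightarrow> ('r, 'd2, 'e2) couple \<Rightarrow> (int \<times> int \<Rightarrow> 'e1 \<Rightarrow> 'e2)
    \<Rightarrow> nat \<Rightarrow> int \<times> int \<Rightarrow> 'e1 set \<Rightarrow> 'e2 set" where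
  "page_map C1 C2 g r x = quot_map (Emod C2 x) (Bsub C2 (r - 1) x) (g x)"

definition page_inf_map :: "('r, 'd1, 'e1) couple \<Rightarrow> ('r, 'd2, 'e2) couple
    \<Rightarrow> (int \<times> int \<Rightarrow> 'e1 \<Rightarrow> 'e2) \<Rightarrow> int \<times> int \<Rightarrow> 'e1 set \<Rightarrow> 'e2 set" where
  "page_inf_map C1 C2 g x = quot_map (Emod C2 x) (\<Union>r. Bsub C2 r x) (g x)"

text \<open>Morphisms of spectral sequences from page \<open>r0\<close> on: linear maps of the pages which commute with
  the differentials, each one being induced on homology by its predecessor. A homology class of
  \<open>E\<^sup>r\<close> is a set of cosets of \<open>B\<^sup>r\<^sup>-\<^sup>1\<close> whose union is a coset of \<open>B\<^sup>r\<close>, and forming this union is the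
  identification of the homology of \<open>E\<^sup>r\<close> with the next page.\<close>

definition ss_morphism :: "('r, 'q) ring_scheme \<Rightarrow> ('r, 'd1, 'e1) couple \<Rightarrow> ('r, 'd2, 'e2) couple
    \<Rightarrow> nat \<Rightarrow> (nat \<Rightarrow> int \<times> int \<Rightarrow> 'e1 set \<Rightarrow> 'e2 set) \<Rightarrow> bool" where
  "ss_morphism R C1 C2 r0 F \<longleftrightarrow> (\<forall>r\<ge>r0. \<forall>x.
     F r x \<in> lin_hom R (page C1 r x) (page C2 r x) \<and>
     (\<forall>U\<in>carrier (page C1 r x).
        F r (x + diff_deg C1 r) (page_diff C1 r x U) = page_diff C2 r x (F r x U)) \<and>
     (\<forall>W\<in>carrier (page_homology C1 r x).
        F (Suc r) x (\<Union>W) = \<Union>(quot_map (page C2 r x) (page_boundaries C2 r x) (F r x) W)))"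

definition ss_isomorphism :: "('r, 'q) ring_scheme \<Rightarrow> ('r, 'd1, 'e1) couple \<Rightarrow> ('r, 'd2, 'e2) couple
    \<Rightarrow> nat \<Rightarrow> (nat \<Rightarrow> int \<times> int \<Rightarrow> 'e1 set \<Rightarrow> 'e2 set) \<Rightarrow> bool" where
  "ss_isomorphism R C1 C2 r0 F \<longleftrightarrow> ss_morphism R C1 C2 r0 F \<and>
     (\<forall>r\<ge>r0. \<forall>x. F r x \<in> lin_iso R (page C1 r x) (page C2 r x))"


section \<open>The colimit abutment\<close>

text \<open>The positions \<open>x\<close> with \<open>det [a x] = n\<close>.\<close>

definition line :: "('r, 'd, 'e) couple \<Rightarrow> int \<Rightarrow> (int \<times> int) set" where
  "line C n = {x. fst (dega C) * snd x - snd (dega C) * fst x = n}"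

text \<open>The colimit is the usual sequential one: elements of the \<open>D\<close> at positions \<open>x\<close> and \<open>x'\<close> are
  identified when they agree after applying powers of \<open>i\<close> into a common position. This is the colimit
  whenever \<open>line C n\<close> is a single orbit under translation by \<open>a\<close>, hence for all \<open>a\<close> with coprime
  entries and in particular for \<open>a = (1, -1)\<close>, where \<open>line C n\<close> consists of the \<open>(p, q)\<close> with
  \<open>p + q = n\<close>. The function \<open>colim_class C x\<close> is the cocone map at \<open>x\<close>.\<close>

definition colim_class ::
  "('r, 'd, 'e) couple \<Rightarrow> int \<times> int \<Rightarrow> 'd \<Rightarrow> ((int \<times> int) \<times> 'd) set" where
  "colim_class C x y = {(x', y'). y' \<in> carrier (Dmod C x') \<and>
     (\<exists>r s. x + zscale (int r) (dega C) = x' + zscale (int s) (dega C) \<and>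
            ipow C r x y = ipow C s x' y')}"

definition colim :: "('r, 'd, 'e) couple \<Rightarrow> int \<Rightarrow> ('r, ((int \<times> int) \<times> 'd) set) module" where
  "colim C n =
    \<lparr>carrier = {colim_class C x y | x y. x \<in> line C n \<and> y \<in> carrier (Dmod C x)},
     mult = undefined, one = undefined,
     zero = (\<Union>x\<in>line C n. colim_class C x \<zero>\<^bsub>Dmod C x\<^esub>),
     add = (\<lambda>U V. \<Union>{colim_class C x (u \<oplus>\<^bsub>Dmod C x\<^esub> v) | x u v. (x, u) \<in> U \<and> (x, v) \<in> V}),
     smult = (\<lambda>r U. \<Union>{colim_class C x (r \<odot>\<^bsub>Dmod C x\<^esub> u) | x u. (x, u) \<in> U})\<rparr>"

definition colim_map :: "('r, 'd2, 'e2) couple \<Rightarrow> (int \<times> int \<Rightarrow> 'd1 \<Rightarrow> 'd2)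
    \<Rightarrow> ((int \<times> int) \<times> 'd1) set \<Rightarrow> ((int \<times> int) \<times> 'd2) set" where
  "colim_map C2 f U = \<Union>{colim_class C2 x (f x u) | x u. (x, u) \<in> U}"

text \<open>The canonical filtration: \<open>filt C (p, q)\<close> is the submodule of the colimit along the line through
  \<open>(p, q)\<close> given by the image of \<open>D\<close> at \<open>(p, q)\<close>.\<close>

definition filt :: "('r, 'd, 'e) couple \<Rightarrow> int \<times> int \<Rightarrow> ((int \<times> int) \<times> 'd) set set" where
  "filt C x = colim_class C x ` carrier (Dmod C x)"

text \<open>The \<open>E\<^sup>\<infinity>\<close>-objects match the colimit abutment, the epimorphisms from the filtration stages onto
  the \<open>E\<^sup>\<infinity>\<close>-objects being the given maps \<open>\<pi>\<close>.\<close>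

definition matches_abutment :: "('r, 'q) ring_scheme \<Rightarrow> ('r, 'd, 'e) couple
    \<Rightarrow> (int \<times> int \<Rightarrow> ((int \<times> int) \<times> 'd) set \<Rightarrow> 'e set) \<Rightarrow> bool" where
  "matches_abutment R C \<pi> \<longleftrightarrow>
     (\<forall>n<0. zero_module (colim C n)) \<and>
     (\<forall>n\<ge>0.
        filt C (-1, n + 1) = {\<zero>\<^bsub>colim C n\<^esub>} \<and>
        filt C (n, 0) = carrier (colim C n) \<and>
        (\<forall>p q. p + q = n \<longrightarrow>
           (let F = (colim C n)\<lparr>carrier := filt C (p, q)\<rparr> in
              filt C (p - 1, q + 1) \<subseteq> filt C (p, q) \<and>
              \<pi> (p, q) \<in> lin_hom R F (page_inf C (p, q)) \<and>
              a_kernel F (page_inf C (p, q)) (\<pi> (p, q)) = filt C (p - 1, q + 1) \<and>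
              \<pi> (p, q) ` filt C (p, q) = carrier (page_inf C (p, q)))))"

definition matchings_compatible :: "('r, 'd1, 'e1) couple \<Rightarrow> ('r, 'd2, 'e2) couple
    \<Rightarrow> (int \<times> int \<Rightarrow> 'd1 \<Rightarrow> 'd2) \<Rightarrow> (int \<times> int \<Rightarrow> 'e1 \<Rightarrow> 'e2)
    \<Rightarrow> (int \<times> int \<Rightarrow> ((int \<times> int) \<times> 'd1) set \<Rightarrow> 'e1 set)
    \<Rightarrow> (int \<times> int \<Rightarrow> ((int \<times> int) \<times> 'd2) set \<Rightarrow> 'e2 set) \<Rightarrow> bool" where
  "matchings_compatible C1 C2 f g \<pi>1 \<pi>2 \<longleftrightarrow>
     (\<forall>p q. p + q \<ge> 0 \<longrightarrow> (\<forall>u\<in>filt C1 (p, q).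
        \<pi>2 (p, q) (colim_map C2 f u) = page_inf_map C1 C2 g (p, q) (\<pi>1 (p, q) u)))"

end

theory Submission
  imports Defs
begin

text \<open>
  This is Zeeman's comparison argument, carried out on the submodules \<open>B\<^sup>s \<subseteq> Z\<^sup>s\<close> of \<open>E\<close> whose quotients are
  the pages \<open>E\<^sup>s\<^sup>+\<^sup>1\<close>. The proof is by induction on \<open>n\<close>: the map \<open>f\<^sup>2\<close> is an isomorphism in all rows
  \<open>q \<le> n\<close>. By the propagation hypothesis the step reduces to the single position \<open>(0, n + 1)\<close>.

  Suppose that \<open>f\<^sup>2\<close> is an isomorphism in the rows \<open>q \<le> n\<close>. Passing from a page to its homology keeps
  the map injective at a position if it is surjective at the source of the incoming differential, and
  keeps it surjective if it is injective at the target of the outgoing one. Differentials lower \<open>p\<close>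
  and raise \<open>q\<close>; hence all \<open>f\<^sup>r\<close> stay injective in the rows \<open>q \<le> n\<close>, whereas surjectivity of \<open>f\<^sup>r\<close>
  survives where \<open>q + r \<le> n + 2\<close>, that is, as long as the targets did not leave these rows
  (\<open>pages_inj_surj\<close>).

  The rows above are reached through the abutment. In each total degree \<open>m\<close> the map of the abutments
  is onto the top filtration stage \<open>F\<^sub>m\<^sub>,\<^sub>0\<close>, and injectivity of \<open>f\<^sup>\<infinity>\<close> at a position pushes surjectivity
  from the stage at that position to the next smaller one (\<open>filt_surj\<close>). So one may descend as far as
  the row \<open>n + 1\<close>, and \<open>f\<^sup>\<infinity>\<close> is surjective in all rows \<open>q \<le> n + 1\<close> (\<open>page_inf_surj\<close>). At \<open>(0, n + 1)\<close>
  it is injective as well, because there \<open>E\<^sup>\<infinity>\<close> is a submodule of the abutment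
  (\<open>page_inf_edge_inj\<close>).

  Finally one goes back from \<open>E\<^sup>\<infinity>\<close> to \<open>E\<^sup>2\<close> at \<open>(0, n + 1)\<close>, where all outgoing differentials vanish, by
  the five lemma for
  \<open>0 \<rightarrow> ker d\<^sup>r \<rightarrow> E\<^sup>r\<^sub>r\<^sub>,\<^sub>n\<^sub>+\<^sub>2\<^sub>-\<^sub>r \<rightarrow> E\<^sup>r\<^sub>0\<^sub>,\<^sub>n\<^sub>+\<^sub>1 \<rightarrow> E\<^sup>r\<^sup>+\<^sup>1\<^sub>0\<^sub>,\<^sub>n\<^sub>+\<^sub>1 \<rightarrow> 0\<close>. The middle term lies in a row \<open>q \<le> n\<close>, and
  surjectivity on the kernels comes from surjectivity of \<open>f\<^sup>\<infinity>\<close> in the total degree \<open>n + 2\<close>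
  (\<open>kernel_surj\<close>, \<open>edge_iso\<close>).
\<close>

section \<open>Linear maps and subquotients\<close>

lemma lin_homD:
  assumes "h \<in> lin_hom R M N"
  shows lin_hom_closed: "x \<in> carrier M \<Longrightarrow> h x \<in> carrier N"
    and lin_hom_add: "\<lbrakk>x \<in> carrier M; y \<in> carrier M\<rbrakk> \<Longrightarrow> h (x \<oplus>\<^bsub>M\<^esub> y) = h x \<oplus>\<^bsub>N\<^esub> h y"
    and lin_hom_smult: "\<lbrakk>r \<in> carrier R; x \<in> carrier M\<rbrakk> \<Longrightarrow> h (r \<odot>\<^bsub>M\<^esub> x) = r \<odot>\<^bsub>N\<^esub> h x"
  using assms by (auto simp: lin_hom_def)

lemma lin_hom_abelian_group_hom:
  assumes "left_module R M" "left_module R N" "h \<in> lin_hom R M N"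
  shows "abelian_group_hom M N h"
proof -
  interpret M: left_module R M by fact
  interpret N: left_module R N by fact
  show ?thesis
    by (rule abelian_group_homI)
       (auto intro!: M.abelian_group_axioms N.abelian_group_axioms group_hom.intro
          group_hom_axioms.intro M.a_group N.a_group simp: hom_def lin_homD[OF assms(3)])
qed

lemma lin_hom_zero:
  assumes "left_module R M" "left_module R N" "h \<in> lin_hom R M N"
  shows "h \<zero>\<^bsub>M\<^esub> = \<zero>\<^bsub>N\<^esub>"
  by (rule abelian_group_hom.hom_zero[OF lin_hom_abelian_group_hom[OF assms]])

lemma lin_hom_minus:
  assumes "left_module R M" "left_module R N" "h \<in> lin_hom R M N"
    and "x \<in> carrier M" "y \<in> carrier M"
  shows "h (x \<ominus>\<^bsub>M\<^esub> y) = h x \<ominus>\<^bsub>N\<^esub> h y"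
proof -
  interpret M: left_module R M by fact
  interpret abelian_group_hom M N h by (rule lin_hom_abelian_group_hom[OF assms(1-3)])
  show ?thesis using assms(4,5) by (simp add: a_minus_def)
qed

context left_module
begin

lemma smult_r_null [simp]: "r \<in> carrier R \<Longrightarrow> r \<odot>\<^bsub>M\<^esub> \<zero>\<^bsub>M\<^esub> = \<zero>\<^bsub>M\<^esub>"
  using smult_r_distr[of r "\<zero>\<^bsub>M\<^esub>" "\<zero>\<^bsub>M\<^esub>"] by simp

lemma smult_r_minus:
  assumes "r \<in> carrier R" "x \<in> carrier M" "y \<in> carrier M"
  shows "r \<odot>\<^bsub>M\<^esub> (x \<ominus>\<^bsub>M\<^esub> y) = r \<odot>\<^bsub>M\<^esub> x \<ominus>\<^bsub>M\<^esub> r \<odot>\<^bsub>M\<^esub> y"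
proof -
  have "r \<odot>\<^bsub>M\<^esub> (\<ominus>\<^bsub>M\<^esub> y) \<oplus>\<^bsub>M\<^esub> r \<odot>\<^bsub>M\<^esub> y = \<zero>\<^bsub>M\<^esub>"
    using assms smult_r_distr[of r "\<ominus>\<^bsub>M\<^esub> y" y] by (simp add: M.l_neg)
  then have "r \<odot>\<^bsub>M\<^esub> (\<ominus>\<^bsub>M\<^esub> y) = \<ominus>\<^bsub>M\<^esub> (r \<odot>\<^bsub>M\<^esub> y)"
    using assms M.minus_equality by simp
  then show ?thesis using assms by (simp add: a_minus_def smult_r_distr)
qed

lemma minus_minus_assoc:
  assumes "x \<in> carrier M" "y \<in> carrier M" "z \<in> carrier M"
  shows "(x \<ominus>\<^bsub>M\<^esub> y) \<ominus>\<^bsub>M\<^esub> z = x \<ominus>\<^bsub>M\<^esub> (y \<oplus>\<^bsub>M\<^esub> z)"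
  using assms by (simp add: a_minus_def M.minus_add M.a_assoc)

lemma minus_zero: "x \<in> carrier M \<Longrightarrow> x \<ominus>\<^bsub>M\<^esub> \<zero>\<^bsub>M\<^esub> = x"
  by (simp add: a_minus_def)

lemma minus_self: "x \<in> carrier M \<Longrightarrow> x \<ominus>\<^bsub>M\<^esub> x = \<zero>\<^bsub>M\<^esub>"
  by (simp add: a_minus_def M.r_neg)

lemma submoduleI':
  assumes "B \<subseteq> carrier M" "\<zero>\<^bsub>M\<^esub> \<in> B"
    and minus: "\<And>x y. \<lbrakk>x \<in> B; y \<in> B\<rbrakk> \<Longrightarrow> x \<ominus>\<^bsub>M\<^esub> y \<in> B"
    and "\<And>r x. \<lbrakk>r \<in> carrier R; x \<in> B\<rbrakk> \<Longrightarrow> r \<odot>\<^bsub>M\<^esub> x \<in> B"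
  shows "submodule B R M"
proof -
  have inv: "\<ominus>\<^bsub>M\<^esub> x \<in> B" if "x \<in> B" for x
    using minus[OF assms(2) that] assms(1) that by (auto simp: a_minus_def)
  have "x \<oplus>\<^bsub>M\<^esub> y \<in> B" if "x \<in> B" "y \<in> B" for x y
    using minus[OF that(1) inv[OF that(2)]] assms(1) that by (auto simp: a_minus_def)
  with inv show ?thesis
    using assms unfolding submodule_def submodule_axioms_def subgroup_def
    by (auto simp: a_inv_def[symmetric])
qed

context
  fixes B
  assumes B: "submodule B R M"
begin

lemma submodule_abelian_subgroup: "abelian_subgroup B M"
  using B by (intro abelian_subgroupI3 additive_subgroupI M.abelian_group_axioms)
    (simp add: submodule_def)

interpretation abelian_subgroup B M by (rule submodule_abelian_subgroup)

lemma submodule_subset: "B \<subseteq> carrier M" by (rule a_subset)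

lemma submodule_zero: "\<zero>\<^bsub>M\<^esub> \<in> B" by simp

lemma submodule_add: "x \<in> B \<Longrightarrow> y \<in> B \<Longrightarrow> x \<oplus>\<^bsub>M\<^esub> y \<in> B" by simp

lemma submodule_minus: "x \<in> B \<Longrightarrow> y \<in> B \<Longrightarrow> x \<ominus>\<^bsub>M\<^esub> y \<in> B"
  by (simp add: a_minus_def)

lemma submodule_smult: "r \<in> carrier R \<Longrightarrow> x \<in> B \<Longrightarrow> r \<odot>\<^bsub>M\<^esub> x \<in> B"
  using B by (simp add: submodule.smult_closed)

lemma submodule_minus_cancel_right:
  assumes "x \<ominus>\<^bsub>M\<^esub> y \<in> B" "y \<in> B" "x \<in> carrier M" shows "x \<in> B"
proof -
  have "(x \<ominus>\<^bsub>M\<^esub> y) \<oplus>\<^bsub>M\<^esub> y = x"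
    using assms by (simp add: a_minus_def M.a_assoc M.l_neg)
  then show ?thesis using a_closed[OF assms(1,2)] by simp
qed

lemma submodule_minus_cancel_left:
  assumes "x \<ominus>\<^bsub>M\<^esub> y \<in> B" "x \<in> B" "y \<in> carrier M" shows "y \<in> B"
proof -
  have x: "x \<in> carrier M" using assms by simp
  have "x \<ominus>\<^bsub>M\<^esub> (x \<ominus>\<^bsub>M\<^esub> y) = y"
    using x assms by (simp add: a_minus_def M.minus_add M.a_assoc[symmetric] M.r_neg)
  then show ?thesis using submodule_minus[OF assms(2,1)] by simp
qed

lemma mem_coset_iff:
  "x \<in> carrier M \<Longrightarrow> u \<in> B +>\<^bsub>M\<^esub> x \<longleftrightarrow> u \<in> carrier M \<and> u \<ominus>\<^bsub>M\<^esub> x \<in> B"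
  using a_rcos_module[of x u] a_elemrcos_carrier[of x u] by (auto simp: a_minus_def)

lemma coset_self: "x \<in> carrier M \<Longrightarrow> x \<in> B +>\<^bsub>M\<^esub> x"
  by (rule a_rcos_self)

lemma coset_eq_iff:
  assumes "x \<in> carrier M" "y \<in> carrier M"
  shows "B +>\<^bsub>M\<^esub> x = B +>\<^bsub>M\<^esub> y \<longleftrightarrow> x \<ominus>\<^bsub>M\<^esub> y \<in> B"
  using assms mem_coset_iff[OF assms(2), of x] coset_self[OF assms(1)] a_repr_independence'
  by metis

lemma coset_eq_self_iff: "x \<in> carrier M \<Longrightarrow> B +>\<^bsub>M\<^esub> x = B \<longleftrightarrow> x \<in> B"
  using coset_self a_rcos_const by blast

lemma coset_add:
  "\<lbrakk>x \<in> carrier M; y \<in> carrier M\<rbrakk> \<Longrightarrow> (B +>\<^bsub>M\<^esub> x) <+>\<^bsub>M\<^esub> (B +>\<^bsub>M\<^esub> y) = B +>\<^bsub>M\<^esub> (x \<oplus>\<^bsub>M\<^esub> y)"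
  by (rule a_rcos_sum)

lemma coset_smult:
  assumes "r \<in> carrier R" "x \<in> carrier M"
  shows "(\<Union>u\<in>B +>\<^bsub>M\<^esub> x. B +>\<^bsub>M\<^esub> (r \<odot>\<^bsub>M\<^esub> u)) = B +>\<^bsub>M\<^esub> (r \<odot>\<^bsub>M\<^esub> x)"
proof -
  have "B +>\<^bsub>M\<^esub> (r \<odot>\<^bsub>M\<^esub> u) = B +>\<^bsub>M\<^esub> (r \<odot>\<^bsub>M\<^esub> x)" if "u \<in> B +>\<^bsub>M\<^esub> x" for u
    using that assms submodule_smult[OF assms(1), of "u \<ominus>\<^bsub>M\<^esub> x"]
    by (simp add: mem_coset_iff coset_eq_iff smult_r_minus)
  then show ?thesis using coset_self[OF assms(2)] by blast
qed

end

end

lemma carrier_quot_module: "carrier (quot_module M Z B) = (\<lambda>z. B +>\<^bsub>M\<^esub> z) ` Z"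
  and zero_quot_module: "\<zero>\<^bsub>quot_module M Z B\<^esub> = B"
  and add_quot_module: "U \<oplus>\<^bsub>quot_module M Z B\<^esub> V = U <+>\<^bsub>M\<^esub> V"
  and smult_quot_module: "r \<odot>\<^bsub>quot_module M Z B\<^esub> U = (\<Union>u\<in>U. B +>\<^bsub>M\<^esub> (r \<odot>\<^bsub>M\<^esub> u))"
  by (simp_all add: quot_module_def)

lemmas quot_module_simps = carrier_quot_module zero_quot_module add_quot_module smult_quot_module

lemma quot_map_coset:
  assumes M: "left_module R M" and N: "left_module R N" and h: "h \<in> lin_hom R M N"
    and B: "submodule B R M" and B': "submodule B' R N" and sub: "h ` B \<subseteq> B'"
    and x: "x \<in> carrier M"
  shows "quot_map N B' h (B +>\<^bsub>M\<^esub> x) = B' +>\<^bsub>N\<^esub> h x"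
proof -
  have "B' +>\<^bsub>N\<^esub> h u = B' +>\<^bsub>N\<^esub> h x" if "u \<in> B +>\<^bsub>M\<^esub> x" for u
  proof -
    have u: "u \<in> carrier M" "u \<ominus>\<^bsub>M\<^esub> x \<in> B"
      using that x by (simp_all add: left_module.mem_coset_iff[OF M B])
    then have "h u \<ominus>\<^bsub>N\<^esub> h x \<in> B'"
      using sub by (simp flip: lin_hom_minus[OF M N h u(1) x]) blast
    then show ?thesis
      using u x lin_hom_closed[OF h] by (simp add: left_module.coset_eq_iff[OF N B'])
  qed
  then show ?thesis
    unfolding quot_map_def using left_module.coset_self[OF M B x] by blast
qed

context
  fixes R :: "('r, 'q) ring_scheme" and M :: "('r, 'm) module" and N :: "('r, 'n) module"
    and h B Z B' Z'
  assumes M: "left_module R M" and N: "left_module R N" and h: "h \<in> lin_hom R M N"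
    and B: "submodule B R M" and B': "submodule B' R N" and sub: "h ` B \<subseteq> B'"
    and Z: "submodule Z R M" and Z': "submodule Z' R N" and subZ: "h ` Z \<subseteq> Z'"
begin

lemma quot_map_lin_hom: "quot_map N B' h \<in> lin_hom R (quot_module M Z B) (quot_module N Z' B')"
proof -
  have zM: "z \<in> carrier M" if "z \<in> Z" for z
    using that left_module.submodule_subset[OF M Z] by blast
  note qc = quot_map_coset[OF M N h B B' sub]
  show ?thesis
    unfolding lin_hom_def
  proof (intro CollectI conjI ballI)
    show "quot_map N B' h \<in> carrier (quot_module M Z B) \<rightarrow> carrier (quot_module N Z' B')"
      using subZ zM by (auto simp: quot_module_simps qc)
  next
    fix U V assume "U \<in> carrier (quot_module M Z B)" "V \<in> carrier (quot_module M Z B)"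
    then obtain u v where uv: "u \<in> Z" "v \<in> Z" "U = B +>\<^bsub>M\<^esub> u" "V = B +>\<^bsub>M\<^esub> v"
      by (auto simp: quot_module_simps)
    interpret M: left_module R M by (rule M)
    show "quot_map N B' h (U \<oplus>\<^bsub>quot_module M Z B\<^esub> V) =
          quot_map N B' h U \<oplus>\<^bsub>quot_module N Z' B'\<^esub> quot_map N B' h V"
      using uv zM lin_hom_closed[OF h]
      by (simp add: quot_module_simps qc M.coset_add[OF B] left_module.coset_add[OF N B']
          lin_hom_add[OF h])
  next
    fix r U assume r: "r \<in> carrier R" and "U \<in> carrier (quot_module M Z B)"
    then obtain u where u: "u \<in> Z" "U = B +>\<^bsub>M\<^esub> u"
      by (auto simp: quot_module_simps)
    interpret M: left_module R M by (rule M)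
    show "quot_map N B' h (r \<odot>\<^bsub>quot_module M Z B\<^esub> U) =
          r \<odot>\<^bsub>quot_module N Z' B'\<^esub> quot_map N B' h U"
      using u r zM lin_hom_closed[OF h]
      by (simp add: quot_module_simps qc M.coset_smult[OF B] left_module.coset_smult[OF N B']
          lin_hom_smult[OF h])
  qed
qed

text \<open>The right-hand side speaks of elements of \<open>M\<close> and \<open>N\<close> only. Isomorphisms of pages are used in this
form throughout, so that diagram chases take place in \<open>E\<close> and not in its subquotients.\<close>

lemma quot_map_lin_iso_iff:
  "quot_map N B' h \<in> lin_iso R (quot_module M Z B) (quot_module N Z' B') \<longleftrightarrow>
     (\<forall>z\<in>Z. h z \<in> B' \<longrightarrow> z \<in> B) \<and> (\<forall>z'\<in>Z'. \<exists>z\<in>Z. z' \<ominus>\<^bsub>N\<^esub> h z \<in> B')"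
proof -
  interpret M: left_module R M by (rule M)
  interpret N: left_module R N by (rule N)
  have zM: "z \<in> carrier M" if "z \<in> Z" for z
    using that M.submodule_subset[OF Z] by blast
  have zN: "z \<in> carrier N" if "z \<in> Z'" for z
    using that N.submodule_subset[OF Z'] by blast
  note qc = quot_map_coset[OF M N h B B' sub]
  have "inj_on (quot_map N B' h) (carrier (quot_module M Z B)) \<longleftrightarrow>
      (\<forall>z\<in>Z. h z \<in> B' \<longrightarrow> z \<in> B)" (is "?inj \<longleftrightarrow> ?ker")
  proof
    assume inj: ?inj
    show ?ker
    proof (intro ballI impI)
      fix z assume z: "z \<in> Z" "h z \<in> B'"
      have "quot_map N B' h (B +>\<^bsub>M\<^esub> z) = quot_map N B' h (B +>\<^bsub>M\<^esub> \<zero>\<^bsub>M\<^esub>)"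
        using z zM lin_hom_closed[OF h] N.submodule_zero[OF B']
        by (simp add: qc lin_hom_zero[OF M N h] N.coset_eq_iff[OF B'] N.minus_zero)
      then have "B +>\<^bsub>M\<^esub> z = B +>\<^bsub>M\<^esub> \<zero>\<^bsub>M\<^esub>"
        by (rule inj_onD[OF inj]) (use z M.submodule_zero[OF Z] in \<open>auto simp: quot_module_simps\<close>)
      then show "z \<in> B"
        using z zM by (simp add: M.coset_eq_iff[OF B] M.minus_zero)
    qed
  next
    assume ker: ?ker
    show ?inj
    proof (rule inj_onI)
      fix U V assume U: "U \<in> carrier (quot_module M Z B)" and V: "V \<in> carrier (quot_module M Z B)"
        and eq: "quot_map N B' h U = quot_map N B' h V"
      from U V obtain u v where uv: "u \<in> Z" "v \<in> Z" "U = B +>\<^bsub>M\<^esub> u" "V = B +>\<^bsub>M\<^esub> v"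
        by (auto simp: quot_module_simps)
      have "h (u \<ominus>\<^bsub>M\<^esub> v) \<in> B'"
        using eq uv zM lin_hom_closed[OF h]
        by (simp add: qc N.coset_eq_iff[OF B'] lin_hom_minus[OF M N h])
      then have "u \<ominus>\<^bsub>M\<^esub> v \<in> B" using ker M.submodule_minus[OF Z] uv by blast
      then show "U = V" using uv zM by (simp add: M.coset_eq_iff[OF B])
    qed
  qed
  moreover have "quot_map N B' h ` carrier (quot_module M Z B) = carrier (quot_module N Z' B')
      \<longleftrightarrow> (\<forall>z'\<in>Z'. \<exists>z\<in>Z. z' \<ominus>\<^bsub>N\<^esub> h z \<in> B')" (is "?img = _ \<longleftrightarrow> ?onto")
  proof -
    have img: "?img = (\<lambda>z. B' +>\<^bsub>N\<^esub> h z) ` Z"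
      using zM by (force simp: quot_module_simps qc image_image)
    have "?onto \<longleftrightarrow> (\<forall>z'\<in>Z'. B' +>\<^bsub>N\<^esub> z' \<in> (\<lambda>z. B' +>\<^bsub>N\<^esub> h z) ` Z)"
      using zM zN lin_hom_closed[OF h] by (auto simp: N.coset_eq_iff[OF B'] image_iff)
    also have "\<dots> \<longleftrightarrow> carrier (quot_module N Z' B') \<subseteq> ?img"
      unfolding img by (auto simp: carrier_quot_module)
    also have "\<dots> \<longleftrightarrow> ?img = carrier (quot_module N Z' B')"
      unfolding img using subZ by (auto simp: carrier_quot_module)
    finally show ?thesis by simp
  qed
  ultimately show ?thesis
    using quot_map_lin_hom by (simp add: lin_iso_def bij_betw_def)
qed

end



section \<open>The spectral sequence of an exact couple\<close>

lemma zscale_0 [simp]: "zscale 0 v = 0"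
  and zscale_add: "zscale (m + n) v = zscale m v + zscale n v"
  and zscale_1 [simp]: "zscale 1 v = v"
  by (auto simp: zscale_def prod_eq_iff algebra_simps)

lemma zscale_Suc: "zscale (int (Suc s)) v = zscale (int s) v + v"
  by (simp add: zscale_def prod_eq_iff algebra_simps)

lemma diff_deg_Suc: "diff_deg C (Suc s) = degb C + degc C - zscale (int s) (dega C)"
  by (simp add: diff_deg_def)

lemma ipow_ipow: "ipow C r (x + zscale (int s) (dega C)) (ipow C s x y) = ipow C (s + r) x y"
proof (induction r)
  case (Suc r)
  have "x + zscale (int s) (dega C) + zscale (int r) (dega C) = x + zscale (int (s + r)) (dega C)"
    by (simp add: zscale_add algebra_simps)
  then have "imap C (x + zscale (int s) (dega C) + zscale (int r) (dega C)) =
      imap C (x + zscale (int (s + r)) (dega C))" by (rule arg_cong)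
  then show ?case using Suc by (simp del: of_nat_add)
qed simp

lemma ipow_Suc_left: "ipow C (Suc s) x y = ipow C s (x + dega C) (imap C x y)"
  using ipow_ipow[of C s x 1 y] by simp

text \<open>The differential of \<open>E\<^sup>s\<^sup>+\<^sup>1\<close> as an additive relation on \<open>E\<close>. Its domain is \<open>Z\<^sup>s\<close>, its range \<open>B\<^sup>s\<^sup>+\<^sup>1\<close>, and its
indeterminacy \<open>B\<^sup>s\<close>; elements related to \<open>0\<close> form \<open>Z\<^sup>s\<^sup>+\<^sup>1\<close>.\<close>

definition diff_rel :: "('r, 'd, 'e) couple \<Rightarrow> nat \<Rightarrow> int \<times> int \<Rightarrow> 'e \<Rightarrow> 'e \<Rightarrow> bool" where
  "diff_rel C s x e w \<longleftrightarrow> (let v = x + degc C - zscale (int s) (dega C) in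
     e \<in> carrier (Emod C x) \<and> (\<exists>y\<in>carrier (Dmod C v). ipow C s v y = kmap C x e \<and> w = jmap C v y))"

context exact_couple
begin

lemma k_zero_iff:
  assumes "e \<in> carrier (Emod C x)"
  shows "kmap C x e = \<zero>\<^bsub>Dmod C (x + degc C)\<^esub> \<longleftrightarrow> e \<in> jmap C (x - degb C) ` carrier (Dmod C (x - degb C))"
  using exact_jk[of "x - degb C"] assms by (auto simp: a_kernel_def')

lemma j_zero_iff:
  assumes "y \<in> carrier (Dmod C x)"
  shows "jmap C x y = \<zero>\<^bsub>Emod C (x + degb C)\<^esub> \<longleftrightarrow> y \<in> imap C (x - dega C) ` carrier (Dmod C (x - dega C))"
  using exact_ij[of x] assms by (auto simp: a_kernel_def')

lemma i_zero_iff: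
  assumes "y \<in> carrier (Dmod C (x + degc C))"
  shows "imap C (x + degc C) y = \<zero>\<^bsub>Dmod C (x + degc C + dega C)\<^esub> \<longleftrightarrow> y \<in> kmap C x ` carrier (Emod C x)"
proof -
  have "x - degb C + dega C + degb C + degc C = x + degc C + dega C" by (simp add: algebra_simps)
  with exact_ki[of "x - degb C"] have "kmap C x ` carrier (Emod C x) =
      a_kernel (Dmod C (x + degc C)) (Dmod C (x + degc C + dega C)) (imap C (x + degc C))"
    by (simp only: diff_add_cancel)
  then show ?thesis using assms by (auto simp: a_kernel_def')
qed

lemma ipow_lin: "ipow C s x \<in> lin_hom R (Dmod C x) (Dmod C (x + zscale (int s) (dega C)))"
proof (induction s)
  case 0
  then show ?case by (simp add: lin_hom_def)
next
  case (Suc s)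
  have pos: "x + zscale (int (Suc s)) (dega C) = x + zscale (int s) (dega C) + dega C"
    by (simp add: zscale_Suc algebra_simps del: of_nat_Suc)
  show ?case
    using Suc i_lin[of "x + zscale (int s) (dega C)"] unfolding pos lin_hom_def
    by (simp add: Pi_iff)
qed

lemma ipow_shift_lin:
  "ipow C s (x - zscale (int s) (dega C)) \<in> lin_hom R (Dmod C (x - zscale (int s) (dega C))) (Dmod C x)"
  using ipow_lin[of s "x - zscale (int s) (dega C)"] by simp

lemmas E_zero_closed = abelian_monoid.zero_closed[OF abelian_group.axioms(1)[OF left_module.axioms(2)[OF E_module]]]
  and D_zero_closed = abelian_monoid.zero_closed[OF abelian_group.axioms(1)[OF left_module.axioms(2)[OF D_module]]]
  and E_minus_closed = abelian_group.minus_closed[OF left_module.axioms(2)[OF E_module]]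
  and D_minus_closed = abelian_group.minus_closed[OF left_module.axioms(2)[OF D_module]]
  and D_smult_closed = left_module.smult_closed[OF D_module]
  and E_smult_closed = left_module.smult_closed[OF E_module]

lemmas E_minus_self = left_module.minus_self[OF E_module]
  and D_minus_self = left_module.minus_self[OF D_module]

lemma Zsub_iff:
  "e \<in> Zsub C s x \<longleftrightarrow> e \<in> carrier (Emod C x) \<and>
     (\<exists>y\<in>carrier (Dmod C (x + degc C - zscale (int s) (dega C))).
        ipow C s (x + degc C - zscale (int s) (dega C)) y = kmap C x e)"
  by (auto simp: Zsub_def Let_def image_iff eq_commute[of "kmap C x e"])

lemma Bsub_iff:
  "w \<in> Bsub C s x \<longleftrightarrow> (\<exists>y\<in>carrier (Dmod C (x - degb C)).
      ipow C s (x - degb C) y = \<zero>\<^bsub>Dmod C (x - degb C + zscale (int s) (dega C))\<^esub> \<and>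
      w = jmap C (x - degb C) y)"
  by (auto simp: Bsub_def Let_def a_kernel_def')

lemma Zsub_submodule: "submodule (Zsub C s x) R (Emod C x)"
proof (rule left_module.submoduleI'[OF E_module])
  let ?v = "x + degc C - zscale (int s) (dega C)"
  note ip = ipow_shift_lin[of s "x + degc C"]
  show "Zsub C s x \<subseteq> carrier (Emod C x)" by (auto simp: Zsub_iff)
  show "\<zero>\<^bsub>Emod C x\<^esub> \<in> Zsub C s x"
    unfolding Zsub_iff using lin_hom_zero[OF D_module D_module ip] E_zero_closed[of x]
      lin_hom_zero[OF E_module D_module k_lin[of x]] D_zero_closed[of ?v] by metis
  fix e e' assume "e \<in> Zsub C s x" "e' \<in> Zsub C s x"
  then obtain y y' where y: "y \<in> carrier (Dmod C ?v)" "ipow C s ?v y = kmap C x e"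
    "y' \<in> carrier (Dmod C ?v)" "ipow C s ?v y' = kmap C x e'"
    and e: "e \<in> carrier (Emod C x)" "e' \<in> carrier (Emod C x)" by (auto simp: Zsub_iff)
  show "e \<ominus>\<^bsub>Emod C x\<^esub> e' \<in> Zsub C s x"
    using lin_hom_minus[OF D_module D_module ip y(1,3)] lin_hom_minus[OF E_module D_module k_lin e]
      D_minus_closed[OF y(1,3)] E_minus_closed[OF e] unfolding Zsub_iff y(2,4) by metis
next
  let ?v = "x + degc C - zscale (int s) (dega C)"
  note ip = ipow_shift_lin[of s "x + degc C"]
  fix r e assume r: "r \<in> carrier R" and "e \<in> Zsub C s x"
  then obtain y where y: "y \<in> carrier (Dmod C ?v)" "ipow C s ?v y = kmap C x e"
    and e: "e \<in> carrier (Emod C x)" by (auto simp: Zsub_iff)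
  show "r \<odot>\<^bsub>Emod C x\<^esub> e \<in> Zsub C s x"
    using lin_hom_smult[OF ip r y(1)] lin_hom_smult[OF k_lin r e]
      D_smult_closed[OF r y(1)] E_smult_closed[OF r e] unfolding Zsub_iff y(2) by metis
qed

lemma jmap_shift_lin: "jmap C (x - degb C) \<in> lin_hom R (Dmod C (x - degb C)) (Emod C x)"
  using j_lin[of "x - degb C"] by simp

lemma Bsub_submodule: "submodule (Bsub C s x) R (Emod C x)"
proof (rule left_module.submoduleI'[OF E_module])
  let ?v = "x - degb C"
  note j = jmap_shift_lin[of x]
  show "Bsub C s x \<subseteq> carrier (Emod C x)" using lin_hom_closed[OF j] by (auto simp: Bsub_iff)
  show "\<zero>\<^bsub>Emod C x\<^esub> \<in> Bsub C s x"
    unfolding Bsub_iff using lin_hom_zero[OF D_module D_module ipow_lin[of s ?v]]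
      lin_hom_zero[OF D_module E_module j] D_zero_closed[of ?v] by metis
  fix e e' assume "e \<in> Bsub C s x" "e' \<in> Bsub C s x"
  then obtain y y' where y: "y \<in> carrier (Dmod C ?v)" "ipow C s ?v y = \<zero>\<^bsub>Dmod C (?v + zscale (int s) (dega C))\<^esub>"
    "y' \<in> carrier (Dmod C ?v)" "ipow C s ?v y' = \<zero>\<^bsub>Dmod C (?v + zscale (int s) (dega C))\<^esub>"
    and e: "e = jmap C ?v y" "e' = jmap C ?v y'" unfolding Bsub_iff by blast
  show "e \<ominus>\<^bsub>Emod C x\<^esub> e' \<in> Bsub C s x"
    using lin_hom_minus[OF D_module D_module ipow_lin[of s ?v] y(1,3)]
      lin_hom_minus[OF D_module E_module j y(1,3)] D_minus_closed[OF y(1,3)]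
    unfolding Bsub_iff e y(2,4) D_minus_self[OF D_zero_closed] by metis
next
  let ?v = "x - degb C"
  note j = jmap_shift_lin[of x]
  fix r e assume r: "r \<in> carrier R" and "e \<in> Bsub C s x"
  then obtain y where y: "y \<in> carrier (Dmod C ?v)" "ipow C s ?v y = \<zero>\<^bsub>Dmod C (?v + zscale (int s) (dega C))\<^esub>"
    and e: "e = jmap C ?v y" unfolding Bsub_iff by blast
  show "r \<odot>\<^bsub>Emod C x\<^esub> e \<in> Bsub C s x"
    using lin_hom_smult[OF ipow_lin[of s ?v] r y(1)] lin_hom_smult[OF j r y(1)] D_smult_closed[OF r y(1)]
    unfolding Bsub_iff e y(2) left_module.smult_r_null[OF D_module r] by metis
qed

lemmas Zsub_subset = left_module.submodule_subset[OF E_module Zsub_submodule]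
  and Bsub_subset = left_module.submodule_subset[OF E_module Bsub_submodule]

lemma Zsub_Suc_subset: "Zsub C (Suc s) x \<subseteq> Zsub C s x"
proof
  let ?v = "x + degc C - zscale (int (Suc s)) (dega C)"
  fix e assume "e \<in> Zsub C (Suc s) x"
  then obtain y where y: "y \<in> carrier (Dmod C ?v)" "ipow C (Suc s) ?v y = kmap C x e"
    and e: "e \<in> carrier (Emod C x)" unfolding Zsub_iff by blast
  have pos: "?v + dega C = x + degc C - zscale (int s) (dega C)"
    by (simp add: zscale_Suc algebra_simps del: of_nat_Suc)
  have "imap C ?v y \<in> carrier (Dmod C (x + degc C - zscale (int s) (dega C)))"
    using lin_hom_closed[OF i_lin y(1)] unfolding pos .
  moreover have "ipow C s (x + degc C - zscale (int s) (dega C)) (imap C ?v y) = kmap C x e"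
    using y(2) unfolding ipow_Suc_left pos .
  ultimately show "e \<in> Zsub C s x"
    using e unfolding Zsub_iff by blast
qed

lemma Bsub_subset_Suc: "Bsub C s x \<subseteq> Bsub C (Suc s) x"
proof
  let ?v = "x - degb C"
  fix w assume "w \<in> Bsub C s x"
  then obtain y where y: "y \<in> carrier (Dmod C ?v)" "w = jmap C ?v y"
    "ipow C s ?v y = \<zero>\<^bsub>Dmod C (?v + zscale (int s) (dega C))\<^esub>" unfolding Bsub_iff by blast
  have "ipow C (Suc s) ?v y = \<zero>\<^bsub>Dmod C (?v + zscale (int s) (dega C) + dega C)\<^esub>"
    using y(3) lin_hom_zero[OF D_module D_module i_lin] by simp
  then show "w \<in> Bsub C (Suc s) x"
    using y(1,2) unfolding Bsub_iff zscale_Suc add.assoc[symmetric] by blast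
qed

lemma Zsub_antimono: "s \<le> t \<Longrightarrow> Zsub C t x \<subseteq> Zsub C s x"
  by (rule lift_Suc_antimono_le[of "\<lambda>s. Zsub C s x"]) (rule Zsub_Suc_subset)

lemma Bsub_mono: "s \<le> t \<Longrightarrow> Bsub C s x \<subseteq> Bsub C t x"
  by (rule lift_Suc_mono_le[of "\<lambda>s. Bsub C s x"]) (rule Bsub_subset_Suc)

lemma Bsub_subset_Zsub: "Bsub C s x \<subseteq> Zsub C t x"
proof
  fix e assume e: "e \<in> Bsub C s x"
  then have e': "e \<in> carrier (Emod C x)" using Bsub_subset by blast
  moreover have "kmap C x e = \<zero>\<^bsub>Dmod C (x + degc C)\<^esub>"
    using e k_zero_iff[OF e'] by (auto simp: Bsub_iff)
  ultimately show "e \<in> Zsub C t x"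
    using lin_hom_zero[OF D_module D_module ipow_shift_lin[of t "x + degc C"]]
      D_zero_closed[of "x + degc C - zscale (int t) (dega C)"]
    unfolding Zsub_iff by metis
qed

lemma diff_rel_iff:
  "diff_rel C s x e w \<longleftrightarrow> e \<in> carrier (Emod C x) \<and>
     (\<exists>y\<in>carrier (Dmod C (x + degc C - zscale (int s) (dega C))).
        ipow C s (x + degc C - zscale (int s) (dega C)) y = kmap C x e \<and>
        w = jmap C (x + degc C - zscale (int s) (dega C)) y)"
  by (simp add: diff_rel_def Let_def)

lemma Zsub_iff_diff_rel: "e \<in> Zsub C s x \<longleftrightarrow> (\<exists>w. diff_rel C s x e w)"
  by (auto simp: diff_rel_iff Zsub_iff)

lemma diff_target:
  "x + degc C - zscale (int s) (dega C) = x + diff_deg C (Suc s) - degb C"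
  "x + degc C - zscale (int s) (dega C) + degb C = x + diff_deg C (Suc s)"
  by (simp_all add: diff_deg_Suc algebra_simps)

text \<open>The composite \<open>k j\<close> is zero, so two preimages under \<open>i\<^sup>s\<close> of \<open>k e\<close> and \<open>k e'\<close> differ by an element of
\<open>ker i\<^sup>s\<close>, whose image under \<open>j\<close> lies in \<open>B\<^sup>s\<close>. As \<open>t\<close> is arbitrary, \<open>e\<close> may even be changed by a
boundary of a later page.\<close>

lemma diff_rel_cong:
  assumes "diff_rel C s x e w" "diff_rel C s x e' w'" "e \<ominus>\<^bsub>Emod C x\<^esub> e' \<in> Bsub C t x"
  shows "w \<ominus>\<^bsub>Emod C (x + diff_deg C (Suc s))\<^esub> w' \<in> Bsub C s (x + diff_deg C (Suc s))"
proof -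
  let ?v = "x + degc C - zscale (int s) (dega C)"
  obtain y y' where y: "y \<in> carrier (Dmod C ?v)" "ipow C s ?v y = kmap C x e" "w = jmap C ?v y"
    and y': "y' \<in> carrier (Dmod C ?v)" "ipow C s ?v y' = kmap C x e'" "w' = jmap C ?v y'"
    and e: "e \<in> carrier (Emod C x)" "e' \<in> carrier (Emod C x)"
    using assms(1,2) unfolding diff_rel_iff by blast
  have "ipow C s ?v (y \<ominus>\<^bsub>Dmod C ?v\<^esub> y') = kmap C x (e \<ominus>\<^bsub>Emod C x\<^esub> e')"
    using y y' e lin_hom_minus[OF D_module D_module ipow_shift_lin[of s "x + degc C"]]
      lin_hom_minus[OF E_module D_module k_lin] by simp
  also have "\<dots> = \<zero>\<^bsub>Dmod C (x + degc C)\<^esub>"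
    using assms(3) k_zero_iff[OF E_minus_closed[OF e]] unfolding Bsub_iff by blast
  finally have "ipow C s ?v (y \<ominus>\<^bsub>Dmod C ?v\<^esub> y') = \<zero>\<^bsub>Dmod C (?v + zscale (int s) (dega C))\<^esub>" by simp
  moreover have "w \<ominus>\<^bsub>Emod C (x + diff_deg C (Suc s))\<^esub> w' = jmap C ?v (y \<ominus>\<^bsub>Dmod C ?v\<^esub> y')"
    using lin_hom_minus[OF D_module E_module j_lin[of ?v] y(1) y'(1)] y y' by (simp add: diff_target(2))
  ultimately show ?thesis
    unfolding Bsub_iff diff_target(1)[symmetric] using D_minus_closed[OF y(1) y'(1)] by blast
qed

lemma diff_rel_minus:
  assumes "diff_rel C s x e w" "diff_rel C s x e' w'"
  shows "diff_rel C s x (e \<ominus>\<^bsub>Emod C x\<^esub> e') (w \<ominus>\<^bsub>Emod C (x + diff_deg C (Suc s))\<^esub> w')"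
proof -
  let ?v = "x + degc C - zscale (int s) (dega C)"
  obtain y y' where y: "y \<in> carrier (Dmod C ?v)" "ipow C s ?v y = kmap C x e" "w = jmap C ?v y"
    and y': "y' \<in> carrier (Dmod C ?v)" "ipow C s ?v y' = kmap C x e'" "w' = jmap C ?v y'"
    and e: "e \<in> carrier (Emod C x)" "e' \<in> carrier (Emod C x)"
    using assms unfolding diff_rel_iff by blast
  show ?thesis
    unfolding diff_rel_iff using y y' e lin_hom_minus[OF D_module D_module ipow_shift_lin[of s "x + degc C"]]
      lin_hom_minus[OF E_module D_module k_lin] lin_hom_minus[OF D_module E_module j_lin[of ?v] y(1) y'(1)]
    by (auto intro!: E_minus_closed bexI[OF _ D_minus_closed[OF y(1) y'(1)]] simp: diff_target(2))
qed

text \<open>An element \<open>y\<close> is killed by \<open>i\<^sup>s\<^sup>+\<^sup>1\<close> iff \<open>i\<^sup>s y\<close> lies in \<open>ker i = im k\<close>.\<close>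

lemma Bsub_Suc_iff_diff_rel:
  "w \<in> Bsub C (Suc s) (x + diff_deg C (Suc s)) \<longleftrightarrow> (\<exists>e. diff_rel C s x e w)"
proof -
  let ?v = "x + degc C - zscale (int s) (dega C)"
  have pos: "?v + zscale (int (Suc s)) (dega C) = x + degc C + dega C"
    by (simp add: zscale_Suc algebra_simps del: of_nat_Suc)
  have "ipow C (Suc s) ?v y = \<zero>\<^bsub>Dmod C (?v + zscale (int (Suc s)) (dega C))\<^esub> \<longleftrightarrow>
      (\<exists>e\<in>carrier (Emod C x). ipow C s ?v y = kmap C x e)" if "y \<in> carrier (Dmod C ?v)" for y
    using i_zero_iff[OF lin_hom_closed[OF ipow_shift_lin[of s "x + degc C"] that]]
    unfolding pos by auto
  then show ?thesis
    unfolding Bsub_iff diff_rel_iff diff_target(1)[symmetric] by blast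
qed

text \<open>Since \<open>ker j = im i\<close>, a preimage \<open>y\<close> of \<open>k e\<close> under \<open>i\<^sup>s\<close> satisfies \<open>j y = 0\<close> iff it shows that \<open>k e\<close>
lies in the image of \<open>i\<^sup>s\<^sup>+\<^sup>1\<close>.\<close>

lemma Zsub_Suc_iff_diff_rel:
  "e \<in> Zsub C (Suc s) x \<longleftrightarrow> diff_rel C s x e \<zero>\<^bsub>Emod C (x + diff_deg C (Suc s))\<^esub>"
proof -
  let ?v = "x + degc C - zscale (int s) (dega C)"
  have pos: "?v - dega C = x + degc C - zscale (int (Suc s)) (dega C)"
    by (simp add: zscale_Suc algebra_simps del: of_nat_Suc)
  have ip: "ipow C (Suc s) (?v - dega C) y = ipow C s ?v (imap C (?v - dega C) y)" for y
    unfolding ipow_Suc_left by simp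
  have cl: "imap C (?v - dega C) y \<in> carrier (Dmod C ?v)" if "y \<in> carrier (Dmod C (?v - dega C))" for y
    using lin_hom_closed[OF i_lin that] by simp
  have "diff_rel C s x e \<zero>\<^bsub>Emod C (x + diff_deg C (Suc s))\<^esub> \<longleftrightarrow> e \<in> carrier (Emod C x) \<and>
      (\<exists>y\<in>carrier (Dmod C ?v). ipow C s ?v y = kmap C x e \<and>
         jmap C ?v y = \<zero>\<^bsub>Emod C (?v + degb C)\<^esub>)"
    unfolding diff_rel_iff diff_target(2) by (simp only: eq_commute[of "\<zero>\<^bsub>Emod C (x + diff_deg C (Suc s))\<^esub>"])
  also have "\<dots> \<longleftrightarrow> e \<in> carrier (Emod C x) \<and>
      (\<exists>y\<in>carrier (Dmod C ?v). ipow C s ?v y = kmap C x e \<and>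
         y \<in> imap C (?v - dega C) ` carrier (Dmod C (?v - dega C)))"
    by (simp only: j_zero_iff cong: bex_cong)
  also have "\<dots> \<longleftrightarrow> e \<in> Zsub C (Suc s) x"
    unfolding Zsub_iff pos[symmetric] ip using cl by blast
  finally show ?thesis by simp
qed

lemma Zsub_SucI:
  assumes "diff_rel C s x e w" "w \<in> Bsub C s (x + diff_deg C (Suc s))"
  shows "e \<in> Zsub C (Suc s) x"
proof -
  let ?v = "x + degc C - zscale (int s) (dega C)" and ?t = "x + diff_deg C (Suc s)"
  obtain y' where y': "y' \<in> carrier (Dmod C ?v)" "ipow C s ?v y' = \<zero>\<^bsub>Dmod C (x + degc C)\<^esub>"
    "w = jmap C ?v y'"
    using assms(2) unfolding Bsub_iff diff_target(1)[symmetric] by auto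
  have e: "e \<in> carrier (Emod C x)" and w: "w \<in> carrier (Emod C ?t)"
    using assms Bsub_subset[of s ?t] unfolding diff_rel_iff by blast+
  \<comment> \<open>The element \<open>w\<close> is in the indeterminacy, and subtracting \<open>0 \<mapsto> w\<close> from \<open>e \<mapsto> w\<close> gives \<open>e \<mapsto> 0\<close>.\<close>
  have "diff_rel C s x \<zero>\<^bsub>Emod C x\<^esub> w"
    unfolding diff_rel_iff using y' lin_hom_zero[OF E_module D_module k_lin] E_zero_closed by metis
  from diff_rel_minus[OF assms(1) this] have "diff_rel C s x e \<zero>\<^bsub>Emod C ?t\<^esub>"
    using e w by (simp add: left_module.minus_zero[OF E_module] E_minus_self)
  then show ?thesis by (simp add: Zsub_Suc_iff_diff_rel)
qed

end



context exact_couple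
begin

lemma diff_rel_carrier:
  assumes "diff_rel C s x e w"
  shows "e \<in> carrier (Emod C x)" "w \<in> carrier (Emod C (x + diff_deg C (Suc s)))"
  using assms Bsub_Suc_iff_diff_rel[of w s x] Bsub_subset[of "Suc s" "x + diff_deg C (Suc s)"]
  by (auto simp: diff_rel_iff)

lemma page_Suc: "page C (Suc s) x = quot_module (Emod C x) (Zsub C s x) (Bsub C s x)"
  by (simp add: page_def)

lemma carrier_page_Suc: "carrier (page C (Suc s) x) = (\<lambda>z. Bsub C s x +>\<^bsub>Emod C x\<^esub> z) ` Zsub C s x"
  by (simp add: page_Suc carrier_quot_module)

lemma zero_pageD:
  assumes "zero_module (page C (Suc s) x)"
  shows "Zsub C s x \<subseteq> Bsub C s x"
proof
  fix z assume z: "z \<in> Zsub C s x"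
  then have "Bsub C s x +>\<^bsub>Emod C x\<^esub> z = Bsub C s x"
    using assms unfolding zero_module_def page_Suc quot_module_simps by blast
  then show "z \<in> Bsub C s x"
    using z Zsub_subset[of s x] left_module.coset_eq_self_iff[OF E_module Bsub_submodule] by blast
qed

lemma page_diff_coset:
  assumes "diff_rel C s x e w"
  shows "page_diff C (Suc s) x (Bsub C s x +>\<^bsub>Emod C x\<^esub> e) =
     Bsub C s (x + diff_deg C (Suc s)) +>\<^bsub>Emod C (x + diff_deg C (Suc s))\<^esub> w"
proof -
  let ?v = "x + degc C - zscale (int s) (dega C)" and ?t = "x + diff_deg C (Suc s)"
  let ?cl = "\<lambda>w. Bsub C s ?t +>\<^bsub>Emod C ?t\<^esub> w" and ?U = "Bsub C s x +>\<^bsub>Emod C x\<^esub> e"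
  note e = diff_rel_carrier[OF assms]
  note mem = left_module.mem_coset_iff[OF E_module Bsub_submodule e(1)]
  have v: "?v = x + degc C - zscale (int (Suc s) - 1) (dega C)" by simp
  have "page_diff C (Suc s) x ?U = (\<Union>e'\<in>?U. \<Union>w'\<in>{w'. diff_rel C s x e' w'}. ?cl w')"
  proof -
    have "(\<Union>y\<in>{y \<in> carrier (Dmod C ?v). ipow C s ?v y = kmap C x e'}. ?cl (jmap C ?v y)) =
        (\<Union>w'\<in>{w'. diff_rel C s x e' w'}. ?cl w')" if "e' \<in> ?U" for e'
      using that unfolding mem diff_rel_iff by blast
    then show ?thesis unfolding page_diff_def Let_def v[symmetric] diff_Suc_1 by (rule SUP_cong[OF refl])
  qed
  also have "\<dots> = ?cl w"
  proof -
    have "?cl w' = ?cl w" if "e' \<in> ?U" "diff_rel C s x e' w'" for e' w'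
      using diff_rel_cong[OF that(2) assms, of s] that e diff_rel_carrier(2)[OF that(2)]
      by (simp add: mem left_module.coset_eq_iff[OF E_module Bsub_submodule])
    moreover have "e \<in> ?U" using e(1) by (rule left_module.coset_self[OF E_module Bsub_submodule])
    ultimately show ?thesis using assms by blast
  qed
  finally show ?thesis .
qed

lemma page_boundaries_eq:
  "page_boundaries C (Suc s) x = (\<lambda>w. Bsub C s x +>\<^bsub>Emod C x\<^esub> w) ` Bsub C (Suc s) x"
proof -
  let ?y = "x - diff_deg C (Suc s)"
  have xy: "?y + diff_deg C (Suc s) = x" by simp
  have "page_boundaries C (Suc s) x =
      {page_diff C (Suc s) ?y (Bsub C s ?y +>\<^bsub>Emod C ?y\<^esub> e) | e. e \<in> Zsub C s ?y}"
    unfolding page_boundaries_def carrier_page_Suc by blast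
  also have "\<dots> = {Bsub C s x +>\<^bsub>Emod C x\<^esub> w | e w. diff_rel C s ?y e w}"
  proof (intro subset_antisym subsetI)
    fix U assume "U \<in> {page_diff C (Suc s) ?y (Bsub C s ?y +>\<^bsub>Emod C ?y\<^esub> e) | e. e \<in> Zsub C s ?y}"
    then obtain e w where "diff_rel C s ?y e w" "U = page_diff C (Suc s) ?y (Bsub C s ?y +>\<^bsub>Emod C ?y\<^esub> e)"
      unfolding Zsub_iff_diff_rel by blast
    with page_diff_coset[of s ?y, unfolded xy]
    show "U \<in> {Bsub C s x +>\<^bsub>Emod C x\<^esub> w | e w. diff_rel C s ?y e w}" by blast
  next
    fix U assume "U \<in> {Bsub C s x +>\<^bsub>Emod C x\<^esub> w | e w. diff_rel C s ?y e w}"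
    then obtain e w where ew: "diff_rel C s ?y e w" "U = Bsub C s x +>\<^bsub>Emod C x\<^esub> w" by blast
    moreover have "e \<in> Zsub C s ?y" using ew unfolding Zsub_iff_diff_rel by blast
    ultimately show "U \<in> {page_diff C (Suc s) ?y (Bsub C s ?y +>\<^bsub>Emod C ?y\<^esub> e) | e. e \<in> Zsub C s ?y}"
      using page_diff_coset[of s ?y, unfolded xy, OF ew(1)] by blast
  qed
  also have "\<dots> = (\<lambda>w. Bsub C s x +>\<^bsub>Emod C x\<^esub> w) ` Bsub C (Suc s) x"
    using Bsub_Suc_iff_diff_rel[of _ s ?y, unfolded xy] by blast
  finally show ?thesis .
qed

lemma homology_class_eq:
  assumes "z \<in> carrier (Emod C x)"
  shows "page_boundaries C (Suc s) x +>\<^bsub>page C (Suc s) x\<^esub> (Bsub C s x +>\<^bsub>Emod C x\<^esub> z) =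
    (\<lambda>b. Bsub C s x +>\<^bsub>Emod C x\<^esub> (b \<oplus>\<^bsub>Emod C x\<^esub> z)) ` Bsub C (Suc s) x"
proof -
  have "(Bsub C s x +>\<^bsub>Emod C x\<^esub> b) \<oplus>\<^bsub>page C (Suc s) x\<^esub> (Bsub C s x +>\<^bsub>Emod C x\<^esub> z) =
      Bsub C s x +>\<^bsub>Emod C x\<^esub> (b \<oplus>\<^bsub>Emod C x\<^esub> z)" if "b \<in> Bsub C (Suc s) x" for b
  proof -
    have "b \<in> carrier (Emod C x)" using that Bsub_subset by blast
    then show ?thesis
      using assms left_module.coset_add[OF E_module Bsub_submodule] by (simp add: page_Suc quot_module_simps)
  qed
  then show ?thesis
    unfolding a_r_coset_def'[of "page C (Suc s) x"] by (force simp: page_boundaries_eq)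
qed

text \<open>The identification of the homology of a page with the next page: the cosets of \<open>B\<^sup>s\<close> that make up a
homology class fill a coset of \<open>B\<^sup>s\<^sup>+\<^sup>1\<close>.\<close>

lemma Union_homology_class:
  assumes "z \<in> carrier (Emod C x)"
  shows "\<Union>(page_boundaries C (Suc s) x +>\<^bsub>page C (Suc s) x\<^esub> (Bsub C s x +>\<^bsub>Emod C x\<^esub> z)) =
    Bsub C (Suc s) x +>\<^bsub>Emod C x\<^esub> z"
proof -
  interpret E: left_module R "Emod C x" by (rule E_module)
  let ?B = "Bsub C s x" and ?B' = "Bsub C (Suc s) x"
  have B'c: "b \<in> carrier (Emod C x)" if "b \<in> ?B'" for b using that Bsub_subset by blast
  have "\<Union>(page_boundaries C (Suc s) x +>\<^bsub>page C (Suc s) x\<^esub> (?B +>\<^bsub>Emod C x\<^esub> z)) =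
     (\<Union>b\<in>?B'. ?B +>\<^bsub>Emod C x\<^esub> (b \<oplus>\<^bsub>Emod C x\<^esub> z))"
    by (simp only: homology_class_eq[OF assms])
  also have "\<dots> = ?B' +>\<^bsub>Emod C x\<^esub> z"
  proof (intro subset_antisym subsetI)
    fix u assume "u \<in> (\<Union>b\<in>?B'. ?B +>\<^bsub>Emod C x\<^esub> (b \<oplus>\<^bsub>Emod C x\<^esub> z))"
    then obtain b where b: "b \<in> ?B'" and "u \<in> ?B +>\<^bsub>Emod C x\<^esub> (b \<oplus>\<^bsub>Emod C x\<^esub> z)" by blast
    then obtain a where a: "a \<in> ?B" and u: "u = a \<oplus>\<^bsub>Emod C x\<^esub> (b \<oplus>\<^bsub>Emod C x\<^esub> z)"
      unfolding a_r_coset_def' by blast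
    have a': "a \<in> ?B'" using a Bsub_subset_Suc by blast
    have "u = (a \<oplus>\<^bsub>Emod C x\<^esub> b) \<oplus>\<^bsub>Emod C x\<^esub> z"
      using B'c[OF a'] B'c[OF b] assms by (simp add: u E.a_assoc)
    then show "u \<in> ?B' +>\<^bsub>Emod C x\<^esub> z"
      using E.submodule_add[OF Bsub_submodule a' b] unfolding a_r_coset_def' by blast
  next
    fix u assume "u \<in> ?B' +>\<^bsub>Emod C x\<^esub> z"
    then obtain b where b: "b \<in> ?B'" and u: "u = b \<oplus>\<^bsub>Emod C x\<^esub> z"
      unfolding a_r_coset_def' by blast
    have "u \<in> ?B +>\<^bsub>Emod C x\<^esub> (b \<oplus>\<^bsub>Emod C x\<^esub> z)"
      unfolding u by (rule E.coset_self[OF Bsub_submodule]) (use B'c[OF b] assms in simp)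
    with b show "u \<in> (\<Union>b\<in>?B'. ?B +>\<^bsub>Emod C x\<^esub> (b \<oplus>\<^bsub>Emod C x\<^esub> z))" by blast
  qed
  finally show ?thesis .
qed

end

section \<open>Morphisms of exact couples on the pages\<close>

locale couple_map = src: exact_couple R C1 + tgt: exact_couple R C2
  for R (structure) and C1 :: "('r, 'd1, 'e1) couple" and C2 :: "('r, 'd2, 'e2) couple" +
  fixes f :: "int \<times> int \<Rightarrow> 'd1 \<Rightarrow> 'd2" and g :: "int \<times> int \<Rightarrow> 'e1 \<Rightarrow> 'e2"
  assumes morphism: "couple_morphism R C1 C2 f g"
begin

lemma deg_eq: "dega C2 = dega C1" "degb C2 = degb C1" "degc C2 = degc C1"
  using morphism by (simp_all add: couple_morphism_def)

lemma diff_deg_eq: "diff_deg C2 s = diff_deg C1 s"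
  by (simp add: diff_deg_def deg_eq)

lemma f_lin: "f x \<in> lin_hom R (Dmod C1 x) (Dmod C2 x)"
  and g_lin: "g x \<in> lin_hom R (Emod C1 x) (Emod C2 x)"
  using morphism unfolding couple_morphism_def by blast+

lemmas f_closed = lin_hom_closed[OF f_lin] and g_closed = lin_hom_closed[OF g_lin]
lemmas g_minus = lin_hom_minus[OF src.E_module tgt.E_module g_lin]

lemma f_imap: "y \<in> carrier (Dmod C1 x) \<Longrightarrow> f (x + dega C1) (imap C1 x y) = imap C2 x (f x y)"
  and g_jmap: "y \<in> carrier (Dmod C1 x) \<Longrightarrow> g (x + degb C1) (jmap C1 x y) = jmap C2 x (f x y)"
  and f_kmap: "e \<in> carrier (Emod C1 x) \<Longrightarrow> f (x + degc C1) (kmap C1 x e) = kmap C2 x (g x e)"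
  using morphism unfolding couple_morphism_def by blast+

lemma f_ipow:
  assumes "y \<in> carrier (Dmod C1 x)"
  shows "f (x + zscale (int s) (dega C1)) (ipow C1 s x y) = ipow C2 s x (f x y)"
proof (induction s)
  case (Suc s)
  have pos: "x + zscale (int (Suc s)) (dega C1) = x + zscale (int s) (dega C1) + dega C1"
    by (simp add: zscale_Suc algebra_simps del: of_nat_Suc)
  show ?case
    using f_imap[OF lin_hom_closed[OF src.ipow_lin[of s x] assms]] Suc
    unfolding pos by (simp add: deg_eq)
qed simp

lemma diff_rel_map:
  assumes "diff_rel C1 s x e w"
  shows "diff_rel C2 s x (g x e) (g (x + diff_deg C1 (Suc s)) w)"
proof -
  let ?v = "x + degc C1 - zscale (int s) (dega C1)"
  obtain y where e: "e \<in> carrier (Emod C1 x)" and y: "y \<in> carrier (Dmod C1 ?v)"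
    "ipow C1 s ?v y = kmap C1 x e" "w = jmap C1 ?v y"
    using assms unfolding src.diff_rel_iff by blast
  have "ipow C2 s ?v (f ?v y) = kmap C2 x (g x e)"
    using f_ipow[OF y(1), of s] f_kmap[OF e] y(2) by simp
  moreover have "g (x + diff_deg C1 (Suc s)) w = jmap C2 ?v (f ?v y)"
    using g_jmap[OF y(1)] unfolding y(3) src.diff_target(2) .
  ultimately show ?thesis
    unfolding tgt.diff_rel_iff deg_eq using f_closed[OF y(1)] g_closed[OF e] by blast
qed

lemma g_Zsub: "g x ` Zsub C1 s x \<subseteq> Zsub C2 s x"
proof (intro image_subsetI)
  fix e assume "e \<in> Zsub C1 s x"
  then obtain w where "diff_rel C1 s x e w" unfolding src.Zsub_iff_diff_rel by blast
  from diff_rel_map[OF this] show "g x e \<in> Zsub C2 s x" unfolding tgt.Zsub_iff_diff_rel by blast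
qed

lemma g_Bsub: "g x ` Bsub C1 s x \<subseteq> Bsub C2 s x"
proof (intro image_subsetI)
  let ?v = "x - degb C1"
  fix w assume "w \<in> Bsub C1 s x"
  then obtain y where y: "y \<in> carrier (Dmod C1 ?v)" "w = jmap C1 ?v y"
    "ipow C1 s ?v y = \<zero>\<^bsub>Dmod C1 (?v + zscale (int s) (dega C1))\<^esub>" unfolding src.Bsub_iff by blast
  have "ipow C2 s ?v (f ?v y) = \<zero>\<^bsub>Dmod C2 (?v + zscale (int s) (dega C1))\<^esub>"
    using f_ipow[OF y(1), of s] lin_hom_zero[OF src.D_module tgt.D_module f_lin] y(3) by metis
  moreover have "g x w = jmap C2 ?v (f ?v y)"
    using g_jmap[OF y(1)] y(2) by simp
  ultimately show "g x w \<in> Bsub C2 s x"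
    unfolding tgt.Bsub_iff deg_eq using f_closed[OF y(1)] by blast
qed

lemma page_map_coset:
  assumes "z \<in> carrier (Emod C1 x)"
  shows "page_map C1 C2 g (Suc s) x (Bsub C1 s x +>\<^bsub>Emod C1 x\<^esub> z) = Bsub C2 s x +>\<^bsub>Emod C2 x\<^esub> g x z"
  using quot_map_coset[OF src.E_module tgt.E_module g_lin src.Bsub_submodule tgt.Bsub_submodule g_Bsub assms]
  by (simp add: page_map_def)

text \<open>The map \<open>g\<close> respects the relation \<open>diff_rel\<close>, which gives compatibility with the differentials. A
homology class represented by \<open>z\<close> has union \<open>B\<^sup>s\<^sup>+\<^sup>1 + z\<close>, and both routes to the next page send it to
\<open>B\<^sup>s\<^sup>+\<^sup>1 + g z\<close>.\<close>

lemma page_map_ss_morphism: "ss_morphism R C1 C2 (Suc r0) (page_map C1 C2 g)"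
  unfolding ss_morphism_def
proof (intro allI impI)
  fix r x assume "Suc r0 \<le> r"
  then obtain s where r: "r = Suc s" by (cases r) auto
  show "page_map C1 C2 g r x \<in> lin_hom R (page C1 r x) (page C2 r x) \<and>
     (\<forall>U\<in>carrier (page C1 r x). page_map C1 C2 g r (x + diff_deg C1 r) (page_diff C1 r x U) =
        page_diff C2 r x (page_map C1 C2 g r x U)) \<and>
     (\<forall>W\<in>carrier (page_homology C1 r x). page_map C1 C2 g (Suc r) x (\<Union>W) =
        \<Union>(quot_map (page C2 r x) (page_boundaries C2 r x) (page_map C1 C2 g r x) W))"
    unfolding r
  proof (intro conjI ballI)
    show "page_map C1 C2 g (Suc s) x \<in> lin_hom R (page C1 (Suc s) x) (page C2 (Suc s) x)"
      using quot_map_lin_hom[OF src.E_module tgt.E_module g_lin src.Bsub_submodule tgt.Bsub_submodule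
          g_Bsub src.Zsub_submodule tgt.Zsub_submodule g_Zsub]
      by (simp add: page_map_def src.page_Suc tgt.page_Suc)
  next
    fix U assume "U \<in> carrier (page C1 (Suc s) x)"
    then obtain e where "e \<in> Zsub C1 s x" and U: "U = Bsub C1 s x +>\<^bsub>Emod C1 x\<^esub> e"
      unfolding src.carrier_page_Suc by blast
    then obtain w where e: "diff_rel C1 s x e w" unfolding src.Zsub_iff_diff_rel by blast
    show "page_map C1 C2 g (Suc s) (x + diff_deg C1 (Suc s)) (page_diff C1 (Suc s) x U) =
        page_diff C2 (Suc s) x (page_map C1 C2 g (Suc s) x U)"
      using tgt.page_diff_coset[OF diff_rel_map[OF e]] src.diff_rel_carrier[OF e]
      by (simp add: U src.page_diff_coset[OF e] page_map_coset diff_deg_eq)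
  next
    fix W assume "W \<in> carrier (page_homology C1 (Suc s) x)"
    then obtain z where z: "z \<in> carrier (Emod C1 x)"
      and W: "W = page_boundaries C1 (Suc s) x +>\<^bsub>page C1 (Suc s) x\<^esub> (Bsub C1 s x +>\<^bsub>Emod C1 x\<^esub> z)"
      using src.Zsub_subset[of s x]
      unfolding page_homology_def carrier_quot_module a_kernel_def' src.carrier_page_Suc by blast
    have "\<Union>(quot_map (page C2 (Suc s) x) (page_boundaries C2 (Suc s) x) (page_map C1 C2 g (Suc s) x) W) =
       (\<Union>U\<in>W. \<Union>(page_boundaries C2 (Suc s) x +>\<^bsub>page C2 (Suc s) x\<^esub> page_map C1 C2 g (Suc s) x U))"
      unfolding quot_map_def by blast
    also have "\<dots> = Bsub C2 (Suc s) x +>\<^bsub>Emod C2 x\<^esub> g x z"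
    proof -
      have "\<Union>(page_boundaries C2 (Suc s) x +>\<^bsub>page C2 (Suc s) x\<^esub> page_map C1 C2 g (Suc s) x U) =
          Bsub C2 (Suc s) x +>\<^bsub>Emod C2 x\<^esub> g x z" if "U \<in> W" for U
      proof -
        obtain b where b: "b \<in> Bsub C1 (Suc s) x"
          and U: "U = Bsub C1 s x +>\<^bsub>Emod C1 x\<^esub> (b \<oplus>\<^bsub>Emod C1 x\<^esub> z)"
          using \<open>U \<in> W\<close> unfolding W src.homology_class_eq[OF z] by blast
        have bc: "b \<in> carrier (Emod C1 x)" using b src.Bsub_subset by blast
        interpret E1: left_module R "Emod C1 x" by (rule src.E_module)
        interpret E2: left_module R "Emod C2 x" by (rule tgt.E_module)
        have "g x (b \<oplus>\<^bsub>Emod C1 x\<^esub> z) = g x b \<oplus>\<^bsub>Emod C2 x\<^esub> g x z"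
          using bc z by (rule lin_hom_add[OF g_lin])
        then have "g x (b \<oplus>\<^bsub>Emod C1 x\<^esub> z) \<in> Bsub C2 (Suc s) x +>\<^bsub>Emod C2 x\<^esub> g x z"
          using g_Bsub[of x "Suc s"] b unfolding a_r_coset_def' by auto
        then have "Bsub C2 (Suc s) x +>\<^bsub>Emod C2 x\<^esub> g x (b \<oplus>\<^bsub>Emod C1 x\<^esub> z) =
            Bsub C2 (Suc s) x +>\<^bsub>Emod C2 x\<^esub> g x z"
          using E2.mem_coset_iff[OF tgt.Bsub_submodule] E2.coset_eq_iff[OF tgt.Bsub_submodule]
            g_closed[OF z] by blast
        then show ?thesis
          using bc z by (simp add: U page_map_coset tgt.Union_homology_class g_closed)
      qed
      moreover have "W \<noteq> {}"
        unfolding W src.homology_class_eq[OF z]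
        using left_module.submodule_zero[OF src.E_module src.Bsub_submodule] by blast
      ultimately show ?thesis by simp
    qed
    also have "\<dots> = page_map C1 C2 g (Suc (Suc s)) x (\<Union>W)"
      unfolding W by (simp add: src.Union_homology_class[OF z] page_map_coset[OF z])
    finally show "page_map C1 C2 g (Suc (Suc s)) x (\<Union>W) = \<Union>(quot_map (page C2 (Suc s) x)
        (page_boundaries C2 (Suc s) x) (page_map C1 C2 g (Suc s) x) W)" by simp
  qed
qed

text \<open>Injectivity and surjectivity of the map from \<open>Z\<^sup>a/B\<^sup>b\<close> of the first couple to \<open>Z\<^sup>a/B\<^sup>b\<close> of the second,
in terms of elements. The quotient makes sense for all \<open>a\<close> and \<open>b\<close>, as every \<open>B\<^sup>b\<close> is contained in
every \<open>Z\<^sup>a\<close>; it is the page \<open>E\<^sup>s\<^sup>+\<^sup>1\<close> for \<open>a = b = s\<close>. With two indices the incoming differentials, which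
affect only \<open>b\<close>, are separated from the outgoing ones, which affect only \<open>a\<close>. Also the kernel of the
differential of \<open>E\<^sup>s\<^sup>+\<^sup>1\<close> is of this form, with \<open>a = s + 1\<close> and \<open>b = s\<close>.\<close>

definition subquot_inj :: "nat \<Rightarrow> nat \<Rightarrow> int \<times> int \<Rightarrow> bool" where
  "subquot_inj a b x \<longleftrightarrow> (\<forall>z\<in>Zsub C1 a x. g x z \<in> Bsub C2 b x \<longrightarrow> z \<in> Bsub C1 b x)"

definition subquot_surj :: "nat \<Rightarrow> nat \<Rightarrow> int \<times> int \<Rightarrow> bool" where
  "subquot_surj a b x \<longleftrightarrow> (\<forall>z'\<in>Zsub C2 a x. \<exists>z\<in>Zsub C1 a x. z' \<ominus>\<^bsub>Emod C2 x\<^esub> g x z \<in> Bsub C2 b x)"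

lemma page_map_iso_iff:
  "page_map C1 C2 g (Suc s) x \<in> lin_iso R (page C1 (Suc s) x) (page C2 (Suc s) x) \<longleftrightarrow>
     subquot_inj s s x \<and> subquot_surj s s x"
  using quot_map_lin_iso_iff[OF src.E_module tgt.E_module g_lin src.Bsub_submodule tgt.Bsub_submodule
          g_Bsub src.Zsub_submodule tgt.Zsub_submodule g_Zsub]
  by (simp add: page_map_def src.page_Suc tgt.page_Suc subquot_inj_def subquot_surj_def)

lemma subquot_inj_mono_cycles: "subquot_inj a b x \<Longrightarrow> a \<le> a' \<Longrightarrow> subquot_inj a' b x"
  using src.Zsub_antimono[of a a' x] unfolding subquot_inj_def by blast

lemma subquot_surj_mono_boundaries: "subquot_surj a b x \<Longrightarrow> b \<le> b' \<Longrightarrow> subquot_surj a b' x"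
  using tgt.Bsub_mono[of b b' x] unfolding subquot_surj_def by blast

text \<open>If \<open>g z\<close> is a boundary \<open>d e'\<close>, then surjectivity at the source makes \<open>e'\<close> the image of some \<open>e\<close>, and
injectivity applies to \<open>z - d e\<close>.\<close>

lemma subquot_inj_Suc:
  assumes "subquot_inj a s (x + diff_deg C1 (Suc s))" and "subquot_surj s s x"
  shows "subquot_inj a (Suc s) (x + diff_deg C1 (Suc s))"
  unfolding subquot_inj_def
proof (intro ballI impI)
  let ?t = "x + diff_deg C1 (Suc s)"
  fix z assume z: "z \<in> Zsub C1 a ?t" and "g ?t z \<in> Bsub C2 (Suc s) ?t"
  then obtain e' where e': "diff_rel C2 s x e' (g ?t z)"
    using tgt.Bsub_Suc_iff_diff_rel[of _ s x] by (auto simp: diff_deg_eq)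
  then have "e' \<in> Zsub C2 s x" unfolding tgt.Zsub_iff_diff_rel by blast
  then obtain e where e: "e \<in> Zsub C1 s x" "e' \<ominus>\<^bsub>Emod C2 x\<^esub> g x e \<in> Bsub C2 s x"
    using assms(2) unfolding subquot_surj_def by blast
  from e(1) obtain w where w: "diff_rel C1 s x e w" unfolding src.Zsub_iff_diff_rel by blast
  have wB: "w \<in> Bsub C1 (Suc s) ?t" using w src.Bsub_Suc_iff_diff_rel[of w s x] by blast
  have zc: "z \<in> carrier (Emod C1 ?t)" and wc: "w \<in> carrier (Emod C1 ?t)"
    using z src.Zsub_subset src.diff_rel_carrier(2)[OF w] by blast+
  have "g ?t z \<ominus>\<^bsub>Emod C2 ?t\<^esub> g ?t w \<in> Bsub C2 s ?t"
    using tgt.diff_rel_cong[OF e' diff_rel_map[OF w] e(2)] by (simp add: diff_deg_eq)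
  then have "g ?t (z \<ominus>\<^bsub>Emod C1 ?t\<^esub> w) \<in> Bsub C2 s ?t"
    by (simp add: g_minus[OF zc wc])
  moreover have "z \<ominus>\<^bsub>Emod C1 ?t\<^esub> w \<in> Zsub C1 a ?t"
    using z wB src.Bsub_subset_Zsub by (blast intro: left_module.submodule_minus[OF src.E_module src.Zsub_submodule])
  ultimately have "z \<ominus>\<^bsub>Emod C1 ?t\<^esub> w \<in> Bsub C1 (Suc s) ?t"
    using assms(1) src.Bsub_subset_Suc unfolding subquot_inj_def by blast
  then show "z \<in> Bsub C1 (Suc s) ?t"
    by (rule left_module.submodule_minus_cancel_right[OF src.E_module src.Bsub_submodule _ wB zc])
qed

text \<open>A cycle \<open>z'\<close> is congruent to some \<open>g z\<close>; injectivity at the target turns \<open>g (d z) = d z' = 0\<close> into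
\<open>d z = 0\<close>.\<close>

lemma subquot_surj_Suc:
  assumes "subquot_surj s b x" and "subquot_inj s s (x + diff_deg C1 (Suc s))"
  shows "subquot_surj (Suc s) b x"
  unfolding subquot_surj_def
proof
  let ?t = "x + diff_deg C1 (Suc s)"
  fix z' assume z': "z' \<in> Zsub C2 (Suc s) x"
  then obtain z where z: "z \<in> Zsub C1 s x" "z' \<ominus>\<^bsub>Emod C2 x\<^esub> g x z \<in> Bsub C2 b x"
    using assms(1) tgt.Zsub_Suc_subset[of s x] unfolding subquot_surj_def by blast
  from z(1) obtain w where w: "diff_rel C1 s x z w" unfolding src.Zsub_iff_diff_rel by blast
  note wc = src.diff_rel_carrier(2)[OF w]
  have "\<zero>\<^bsub>Emod C2 ?t\<^esub> \<ominus>\<^bsub>Emod C2 ?t\<^esub> g ?t w \<in> Bsub C2 s ?t"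
    using tgt.diff_rel_cong[OF _ diff_rel_map[OF w] z(2)] z' unfolding tgt.Zsub_Suc_iff_diff_rel diff_deg_eq by blast
  then have "g ?t w \<in> Bsub C2 s ?t"
    using left_module.submodule_minus_cancel_left[OF tgt.E_module tgt.Bsub_submodule]
      left_module.submodule_zero[OF tgt.E_module tgt.Bsub_submodule] g_closed[OF wc] by blast
  moreover have "w \<in> Zsub C1 s ?t"
    using w src.Bsub_Suc_iff_diff_rel[of w s x] src.Bsub_subset_Zsub by blast
  ultimately have "w \<in> Bsub C1 s ?t" using assms(2) unfolding subquot_inj_def by blast
  with w have "z \<in> Zsub C1 (Suc s) x" by (rule src.Zsub_SucI)
  with z(2) show "\<exists>z\<in>Zsub C1 (Suc s) x. z' \<ominus>\<^bsub>Emod C2 x\<^esub> g x z \<in> Bsub C2 b x" by blast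
qed

text \<open>The error term \<open>z' - g z\<close> is a boundary \<open>d e'\<close>. Surjectivity at the source makes \<open>e'\<close> the image of
some \<open>e\<close>, and replacing \<open>z\<close> by \<open>z + d e\<close> removes the error.\<close>

lemma subquot_surj_boundaries_down:
  assumes "subquot_surj a (Suc s) (x + diff_deg C1 (Suc s))" and "subquot_surj s s x"
  shows "subquot_surj a s (x + diff_deg C1 (Suc s))"
  unfolding subquot_surj_def
proof
  let ?t = "x + diff_deg C1 (Suc s)"
  fix z' assume z': "z' \<in> Zsub C2 a ?t"
  then obtain z where z: "z \<in> Zsub C1 a ?t" "z' \<ominus>\<^bsub>Emod C2 ?t\<^esub> g ?t z \<in> Bsub C2 (Suc s) ?t"
    using assms(1) unfolding subquot_surj_def by blast
  then obtain e' where e': "diff_rel C2 s x e' (z' \<ominus>\<^bsub>Emod C2 ?t\<^esub> g ?t z)"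
    using tgt.Bsub_Suc_iff_diff_rel[of _ s x] by (auto simp: diff_deg_eq)
  then have "e' \<in> Zsub C2 s x" unfolding tgt.Zsub_iff_diff_rel by blast
  then obtain e where e: "e \<in> Zsub C1 s x" "e' \<ominus>\<^bsub>Emod C2 x\<^esub> g x e \<in> Bsub C2 s x"
    using assms(2) unfolding subquot_surj_def by blast
  from e(1) obtain w where w: "diff_rel C1 s x e w" unfolding src.Zsub_iff_diff_rel by blast
  have c: "z \<in> carrier (Emod C1 ?t)" "w \<in> carrier (Emod C1 ?t)" "z' \<in> carrier (Emod C2 ?t)"
    using z z' src.Zsub_subset tgt.Zsub_subset src.diff_rel_carrier(2)[OF w] by blast+
  have "(z' \<ominus>\<^bsub>Emod C2 ?t\<^esub> g ?t z) \<ominus>\<^bsub>Emod C2 ?t\<^esub> g ?t w \<in> Bsub C2 s ?t"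
    using tgt.diff_rel_cong[OF e' diff_rel_map[OF w] e(2)] by (simp add: diff_deg_eq)
  then have "z' \<ominus>\<^bsub>Emod C2 ?t\<^esub> g ?t (z \<oplus>\<^bsub>Emod C1 ?t\<^esub> w) \<in> Bsub C2 s ?t"
    using c g_closed[OF c(1)] g_closed[OF c(2)]
    by (simp add: left_module.minus_minus_assoc[OF tgt.E_module] lin_hom_add[OF g_lin])
  moreover have "w \<in> Zsub C1 a ?t"
    using w src.Bsub_Suc_iff_diff_rel[of w s x] src.Bsub_subset_Zsub by blast
  then have "z \<oplus>\<^bsub>Emod C1 ?t\<^esub> w \<in> Zsub C1 a ?t"
    using z(1) left_module.submodule_add[OF src.E_module src.Zsub_submodule] by blast
  ultimately show "\<exists>z\<in>Zsub C1 a ?t. z' \<ominus>\<^bsub>Emod C2 ?t\<^esub> g ?t z \<in> Bsub C2 s ?t" by blast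
qed

text \<open>The injectivity half of the five lemma for \<open>ker d \<rightarrow> E\<^sup>s\<^sup>+\<^sup>1 \<rightarrow> Z\<^sup>a/B\<^sup>s \<rightarrow> Z\<^sup>a/B\<^sup>s\<^sup>+\<^sup>1\<close>: an element with image zero is a
boundary \<open>d e\<close>, and \<open>g e\<close> is a cycle. It comes from a cycle \<open>e1\<close>, so that \<open>e\<close> and \<open>e1\<close> agree up to a
boundary, and \<open>d e = d e1 = 0\<close>.\<close>

lemma subquot_inj_boundaries_down:
  assumes "subquot_inj a (Suc s) (x + diff_deg C1 (Suc s))" and "subquot_inj s s x" "subquot_surj (Suc s) s x"
  shows "subquot_inj a s (x + diff_deg C1 (Suc s))"
  unfolding subquot_inj_def
proof (intro ballI impI)
  let ?t = "x + diff_deg C1 (Suc s)"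
  fix z assume z: "z \<in> Zsub C1 a ?t" and gz: "g ?t z \<in> Bsub C2 s ?t"
  then have "z \<in> Bsub C1 (Suc s) ?t"
    using assms(1) tgt.Bsub_subset_Suc unfolding subquot_inj_def by blast
  then obtain e where e: "diff_rel C1 s x e z" using src.Bsub_Suc_iff_diff_rel[of _ s x] by blast
  have "g x e \<in> Zsub C2 (Suc s) x"
    using tgt.Zsub_SucI[OF diff_rel_map[OF e]] gz by (simp add: diff_deg_eq)
  then obtain e1 where e1: "e1 \<in> Zsub C1 (Suc s) x" "g x e \<ominus>\<^bsub>Emod C2 x\<^esub> g x e1 \<in> Bsub C2 s x"
    using assms(3) unfolding subquot_surj_def by blast
  have ec: "e \<in> carrier (Emod C1 x)" "e1 \<in> carrier (Emod C1 x)"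
    using src.diff_rel_carrier(1)[OF e] e1(1) src.Zsub_subset by blast+
  have "e \<in> Zsub C1 s x" using e unfolding src.Zsub_iff_diff_rel by blast
  then have "e \<ominus>\<^bsub>Emod C1 x\<^esub> e1 \<in> Zsub C1 s x"
    using e1(1) src.Zsub_Suc_subset[of s x] left_module.submodule_minus[OF src.E_module src.Zsub_submodule]
    by blast
  then have "e \<ominus>\<^bsub>Emod C1 x\<^esub> e1 \<in> Bsub C1 s x"
    using assms(2) e1(2) unfolding subquot_inj_def by (simp add: g_minus[OF ec])
  moreover have "diff_rel C1 s x e1 \<zero>\<^bsub>Emod C1 ?t\<^esub>" using e1(1) by (simp add: src.Zsub_Suc_iff_diff_rel)
  ultimately have "z \<ominus>\<^bsub>Emod C1 ?t\<^esub> \<zero>\<^bsub>Emod C1 ?t\<^esub> \<in> Bsub C1 s ?t"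
    using src.diff_rel_cong[OF e] by blast
  then show "z \<in> Bsub C1 s ?t"
    using src.diff_rel_carrier(2)[OF e] by (simp add: left_module.minus_zero[OF src.E_module])
qed

end



section \<open>First-quadrant spectral sequences\<close>

context exact_couple
begin

text \<open>The hypothesis says that the target of the differential on \<open>E\<^sup>s\<^sup>+\<^sup>1\<close> is zero.\<close>

lemma Zsub_Suc_eq:
  assumes "Zsub C s (x + diff_deg C (Suc s)) \<subseteq> Bsub C s (x + diff_deg C (Suc s))"
  shows "Zsub C (Suc s) x = Zsub C s x"
proof (rule subset_antisym[OF Zsub_Suc_subset subsetI])
  fix z assume "z \<in> Zsub C s x"
  then obtain w where w: "diff_rel C s x z w" unfolding Zsub_iff_diff_rel by blast
  then have "w \<in> Bsub C (Suc s) (x + diff_deg C (Suc s))" unfolding Bsub_Suc_iff_diff_rel by blast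
  with w assms Bsub_subset_Zsub show "z \<in> Zsub C (Suc s) x" by (blast intro: Zsub_SucI)
qed

lemma Bsub_Suc_eq:
  assumes "Zsub C s x \<subseteq> Bsub C s x"
  shows "Bsub C (Suc s) (x + diff_deg C (Suc s)) = Bsub C s (x + diff_deg C (Suc s))"
proof (rule subset_antisym[OF subsetI Bsub_subset_Suc])
  fix w assume "w \<in> Bsub C (Suc s) (x + diff_deg C (Suc s))"
  then obtain e where e: "diff_rel C s x e w" unfolding Bsub_Suc_iff_diff_rel by blast
  then have "e \<in> Zsub C s x" unfolding Zsub_iff_diff_rel by blast
  then have "e \<ominus>\<^bsub>Emod C x\<^esub> \<zero>\<^bsub>Emod C x\<^esub> \<in> Bsub C s x"
    using assms diff_rel_carrier(1)[OF e] by (simp add: left_module.minus_zero[OF E_module]) blast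
  moreover have "diff_rel C s x \<zero>\<^bsub>Emod C x\<^esub> \<zero>\<^bsub>Emod C (x + diff_deg C (Suc s))\<^esub>"
    using left_module.submodule_zero[OF E_module Zsub_submodule] Zsub_Suc_iff_diff_rel by blast
  ultimately have "w \<ominus>\<^bsub>Emod C (x + diff_deg C (Suc s))\<^esub> \<zero>\<^bsub>Emod C (x + diff_deg C (Suc s))\<^esub>
      \<in> Bsub C s (x + diff_deg C (Suc s))"
    using diff_rel_cong[OF e] by blast
  then show "w \<in> Bsub C s (x + diff_deg C (Suc s))"
    using diff_rel_carrier(2)[OF e] by (simp add: left_module.minus_zero[OF E_module])
qed

end

locale first_quadrant_couple = exact_couple R C for R (structure) and C :: "('a, 'd, 'e) couple" +
  assumes vanishing: "\<And>r p q. r \<ge> 2 \<Longrightarrow> p < 0 \<or> q < 0 \<Longrightarrow> zero_module (page C r (p, q))"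
    and bidegree: "\<And>r. r \<ge> 2 \<Longrightarrow> diff_deg C r = (- int r, int r - 1)"
begin

lemma diff_deg_Suc_eq: "s \<ge> 1 \<Longrightarrow> diff_deg C (Suc s) = (- int s - 1, int s)"
  using bidegree[of "Suc s"] by simp

lemma dega_eq: "dega C = (1, -1)"
  using bidegree[of 2] bidegree[of 3] by (auto simp: diff_deg_def zscale_def prod_eq_iff)

lemma Zsub_subset_Bsub: "\<lbrakk>s \<ge> 1; p < 0 \<or> q < 0\<rbrakk> \<Longrightarrow> Zsub C s (p, q) \<subseteq> Bsub C s (p, q)"
  by (rule zero_pageD, rule vanishing) auto

text \<open>From page \<open>s0 + 1 > p\<close> on, outgoing differentials end in columns left of column zero.\<close>

lemma Zsub_stable:
  assumes "s0 \<ge> 1" "p \<le> int s0" "s0 \<le> s"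
  shows "Zsub C s (p, q) = Zsub C s0 (p, q)"
  using assms(3)
proof (induction rule: dec_induct)
  case (step s)
  have "Zsub C (Suc s) (p, q) = Zsub C s (p, q)"
  proof (rule Zsub_Suc_eq)
    have t: "(p, q) + diff_deg C (Suc s) = (p - int s - 1, q + int s)"
      using assms(1) step(1) by (simp add: diff_deg_Suc_eq)
    show "Zsub C s ((p, q) + diff_deg C (Suc s)) \<subseteq> Bsub C s ((p, q) + diff_deg C (Suc s))"
      unfolding t using assms step(1) by (intro Zsub_subset_Bsub) auto
  qed
  with step show ?case by simp
qed simp

text \<open>From page \<open>s0 + 1 > q + 1\<close> on, incoming differentials start in rows below row zero.\<close>

lemma Bsub_stable:
  assumes "s0 \<ge> 1" "q < int s0" "s0 \<le> s"
  shows "Bsub C s (p, q) = Bsub C s0 (p, q)"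
  using assms(3)
proof (induction rule: dec_induct)
  case (step s)
  have "(p + int s + 1, q - int s) + diff_deg C (Suc s) = (p, q)"
    using assms step(1) by (simp add: diff_deg_Suc_eq)
  moreover have "Zsub C s (p + int s + 1, q - int s) \<subseteq> Bsub C s (p + int s + 1, q - int s)"
    using assms step(1) by (intro Zsub_subset_Bsub) auto
  ultimately have "Bsub C (Suc s) (p, q) = Bsub C s (p, q)"
    using Bsub_Suc_eq[of s "(p + int s + 1, q - int s)"] by simp
  with step show ?case by simp
qed simp

lemma Union_Bsub:
  assumes "s \<ge> 1" "q < int s"
  shows "(\<Union>r. Bsub C r (p, q)) = Bsub C s (p, q)"
proof -
  have "Bsub C r (p, q) \<subseteq> Bsub C s (p, q)" for r
    using Bsub_mono[of r s] Bsub_stable[OF assms, of r p] by (cases "r \<le> s") auto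
  then show ?thesis by blast
qed

text \<open>Once cycles and boundaries at \<open>(p, q)\<close> have become stable, the page is equal to \<open>E\<^sup>\<infinity>\<close>.\<close>

lemma page_inf_eq:
  assumes "s \<ge> 1" "p \<le> int s" "q < int s"
  shows "page_inf C (p, q) = page C (Suc s) (p, q)"
proof -
  have "Zsub C s (p, q) \<subseteq> Zsub C r (p, q)" for r
    using Zsub_antimono[of r s] Zsub_stable[OF assms(1,2), of r q] by (cases "r \<le> s") auto
  then have "(\<Inter>r. Zsub C r (p, q)) = Zsub C s (p, q)" by blast
  then show ?thesis by (simp add: page_inf_def page_Suc Union_Bsub[OF assms(1,3)])
qed

lemma filt_subset_colim: "filt C (p, q) \<subseteq> carrier (colim C (p + q))"
proof -
  have "(p, q) \<in> line C (p + q)" by (simp add: line_def dega_eq)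
  then show ?thesis unfolding filt_def colim_def by auto
qed

end

section \<open>The colimit and its filtration\<close>

lemma colim_class_iff:
  "(x', y') \<in> colim_class C x y \<longleftrightarrow> y' \<in> carrier (Dmod C x') \<and>
     (\<exists>r s. x + zscale (int r) (dega C) = x' + zscale (int s) (dega C) \<and> ipow C r x y = ipow C s x' y')"
  by (simp add: colim_class_def)

text \<open>The identification in the colimit is transitive: two witnesses are moved to a common position by
further powers of \<open>i\<close>, and these powers commute.\<close>

lemma colim_class_eqI:
  assumes "x + zscale (int r) (dega C) = x' + zscale (int s) (dega C)" "ipow C r x y = ipow C s x' y'"
  shows "colim_class C x y = colim_class C x' y'"
proof -
  have sub: "colim_class C x y \<subseteq> colim_class C x' y'"
    if eq: "x + zscale (int r) (dega C) = x' + zscale (int s) (dega C)" "ipow C r x y = ipow C s x' y'"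
    for x y x' y' r s
  proof (intro subrelI)
    fix z u assume "(z, u) \<in> colim_class C x y"
    then obtain r' s' where u: "u \<in> carrier (Dmod C z)"
      and eq': "x + zscale (int r') (dega C) = z + zscale (int s') (dega C)"
        "ipow C r' x y = ipow C s' z u"
      unfolding colim_class_iff by blast
    have "x' + zscale (int (s + r')) (dega C) = (x' + zscale (int s) (dega C)) + zscale (int r') (dega C)"
      by (simp add: zscale_add add.assoc)
    also have "\<dots> = (x + zscale (int r') (dega C)) + zscale (int r) (dega C)"
      unfolding eq(1)[symmetric] by (simp add: algebra_simps)
    also have "\<dots> = z + zscale (int (s' + r)) (dega C)"
      unfolding eq'(1) by (simp add: zscale_add add.assoc)
    finally have pos: "x' + zscale (int (s + r')) (dega C) = z + zscale (int (s' + r)) (dega C)" .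
    have "ipow C (s + r') x' y' = ipow C r' (x + zscale (int r) (dega C)) (ipow C r x y)"
      unfolding eq ipow_ipow ..
    also have "\<dots> = ipow C r (x + zscale (int r') (dega C)) (ipow C r' x y)"
      unfolding ipow_ipow add.commute[of r r'] ..
    also have "\<dots> = ipow C (s' + r) z u"
      unfolding eq' ipow_ipow ..
    finally show "(z, u) \<in> colim_class C x' y'"
      using u pos unfolding colim_class_iff by blast
  qed
  show ?thesis using sub[OF assms] sub[OF assms[symmetric]] by blast
qed

context couple_map
begin

lemma colim_map_class:
  assumes "y \<in> carrier (Dmod C1 x)"
  shows "colim_map C2 f (colim_class C1 x y) = colim_class C2 x (f x y)"
proof -
  have "colim_class C2 x' (f x' u) = colim_class C2 x (f x y)" if rel: "(x', u) \<in> colim_class C1 x y" for x' u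
  proof -
    obtain r s where u: "u \<in> carrier (Dmod C1 x')"
      and eq: "x + zscale (int r) (dega C1) = x' + zscale (int s) (dega C1)" "ipow C1 r x y = ipow C1 s x' u"
      using rel unfolding colim_class_iff by blast
    have "ipow C2 r x (f x y) = ipow C2 s x' (f x' u)"
      using f_ipow[OF assms, of r] f_ipow[OF u, of s] by (simp add: eq)
    then show ?thesis using eq(1) by (intro colim_class_eqI[symmetric]) (simp_all add: deg_eq)
  qed
  moreover have "(x, y) \<in> colim_class C1 x y" using assms unfolding colim_class_iff by blast
  ultimately show ?thesis unfolding colim_map_def by blast
qed

lemma colim_map_filt: "u \<in> filt C1 x \<Longrightarrow> colim_map C2 f u \<in> filt C2 x"
  unfolding filt_def using f_closed[of _ x] by (auto simp: colim_map_class)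

end

lemma matches_abutmentD:
  assumes "matches_abutment R C \<pi>" "p + q \<ge> 0"
  shows filt_mono: "filt C (p - 1, q + 1) \<subseteq> filt C (p, q)"
    and \<pi>_closed: "u \<in> filt C (p, q) \<Longrightarrow> \<pi> (p, q) u \<in> carrier (page_inf C (p, q))"
    and \<pi>_zero_iff: "u \<in> filt C (p, q) \<Longrightarrow>
      \<pi> (p, q) u = \<zero>\<^bsub>page_inf C (p, q)\<^esub> \<longleftrightarrow> u \<in> filt C (p - 1, q + 1)"
    and \<pi>_onto: "U \<in> carrier (page_inf C (p, q)) \<Longrightarrow> \<exists>u\<in>filt C (p, q). U = \<pi> (p, q) u"
proof -
  let ?F = "(colim C (p + q))\<lparr>carrier := filt C (p, q)\<rparr>"
  have *: "filt C (p - 1, q + 1) \<subseteq> filt C (p, q)"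
    "\<pi> (p, q) \<in> lin_hom R ?F (page_inf C (p, q))"
    "a_kernel ?F (page_inf C (p, q)) (\<pi> (p, q)) = filt C (p - 1, q + 1)"
    "\<pi> (p, q) ` filt C (p, q) = carrier (page_inf C (p, q))"
    using assms unfolding matches_abutment_def Let_def by blast+
  show "filt C (p - 1, q + 1) \<subseteq> filt C (p, q)" by (fact *(1))
  show "u \<in> filt C (p, q) \<Longrightarrow> \<pi> (p, q) u \<in> carrier (page_inf C (p, q))" using *(4) by blast
  show "u \<in> filt C (p, q) \<Longrightarrow>
      \<pi> (p, q) u = \<zero>\<^bsub>page_inf C (p, q)\<^esub> \<longleftrightarrow> u \<in> filt C (p - 1, q + 1)"
    unfolding *(3)[symmetric] a_kernel_def' by simp
  show "U \<in> carrier (page_inf C (p, q)) \<Longrightarrow> \<exists>u\<in>filt C (p, q). U = \<pi> (p, q) u"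
    using *(4) by blast
qed

lemma matches_abutment_ends:
  assumes "matches_abutment R C \<pi>" "n \<ge> 0"
  shows "filt C (-1, n + 1) = {\<zero>\<^bsub>colim C n\<^esub>}" "filt C (n, 0) = carrier (colim C n)"
  using assms unfolding matches_abutment_def by blast+

section \<open>Comparison through the abutment\<close>

locale abutment_comparison = couple_map R C1 C2 f g +
    src: first_quadrant_couple R C1 + tgt: first_quadrant_couple R C2
  for R (structure) and C1 :: "('r, 'd1, 'e1) couple" and C2 :: "('r, 'd2, 'e2) couple" and f g +
  fixes \<pi>1 :: "int \<times> int \<Rightarrow> ((int \<times> int) \<times> 'd1) set \<Rightarrow> 'e1 set"
    and \<pi>2 :: "int \<times> int \<Rightarrow> ((int \<times> int) \<times> 'd2) set \<Rightarrow> 'e2 set"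
  assumes matching1: "matches_abutment R C1 \<pi>1"
    and matching2: "matches_abutment R C2 \<pi>2"
    and compatible: "matchings_compatible C1 C2 f g \<pi>1 \<pi>2"
    and abutment_iso: "\<And>n. colim_map C2 f \<in> lin_iso R (colim C1 n) (colim C2 n)"
begin

abbreviation "iso_upto n \<equiv> \<forall>p q. q \<le> n \<longrightarrow> subquot_inj 1 1 (p, q) \<and> subquot_surj 1 1 (p, q)"

lemma source_eq: "s \<ge> 1 \<Longrightarrow> (p + int s + 1, q - int s) + diff_deg C1 (Suc s) = (p, q)"
  by (simp add: src.diff_deg_Suc_eq)

lemma subquot_surj_vanishing:
  assumes "s \<ge> 1" "s \<le> a" "p < 0 \<or> q < 0"
  shows "subquot_surj a s (p, q)"
  unfolding subquot_surj_def
proof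
  fix z' assume z': "z' \<in> Zsub C2 a (p, q)"
  then have "z' \<in> Bsub C2 s (p, q)"
    using tgt.Zsub_subset_Bsub[OF assms(1,3)] tgt.Zsub_antimono[OF assms(2)] by blast
  then have "z' \<ominus>\<^bsub>Emod C2 (p, q)\<^esub> g (p, q) \<zero>\<^bsub>Emod C1 (p, q)\<^esub> \<in> Bsub C2 s (p, q)"
    using z' tgt.Zsub_subset[of a "(p, q)"]
    by (subst lin_hom_zero[OF src.E_module tgt.E_module g_lin], subst left_module.minus_zero[OF tgt.E_module]) auto
  then show "\<exists>z\<in>Zsub C1 a (p, q). z' \<ominus>\<^bsub>Emod C2 (p, q)\<^esub> g (p, q) z \<in> Bsub C2 s (p, q)"
    using left_module.submodule_zero[OF src.E_module src.Zsub_submodule] by blast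
qed

text \<open>The two halves need each other at the preceding page, hence the simultaneous induction. An incoming differential of
\<open>E\<^sup>s\<^sup>+\<^sup>1\<close> starts \<open>s\<close> rows lower, at a position where surjectivity is still known; an outgoing one ends
\<open>s\<close> rows higher, still in a row up to \<open>n\<close> by the bound required for \<open>E\<^sup>s\<^sup>+\<^sup>2\<close>.\<close>

lemma pages_inj_surj:
  assumes "iso_upto n" "s \<ge> 1"
  shows "(\<forall>p q. q \<le> n \<longrightarrow> subquot_inj 1 s (p, q)) \<and> (\<forall>p q. q + int s \<le> n + 1 \<longrightarrow> subquot_surj s 1 (p, q))"
  using assms(2)
proof (induction rule: dec_induct)
  case base
  then show ?case using assms(1) by simp
next
  case (step s)
  show ?case
  proof (intro conjI allI impI)
    fix p q assume "q \<le> n"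
    moreover have "subquot_surj s 1 (p + int s + 1, q - int s)"
      using step \<open>q \<le> n\<close> by simp
    then have "subquot_surj s s (p + int s + 1, q - int s)"
      using step(1) by (rule subquot_surj_mono_boundaries)
    ultimately show "subquot_inj 1 (Suc s) (p, q)"
      using subquot_inj_Suc[of 1 s "(p + int s + 1, q - int s)"] step source_eq[OF step(1)] by simp
  next
    fix p q assume q: "q + int (Suc s) \<le> n + 1"
    have t: "(p, q) + diff_deg C1 (Suc s) = (p - int s - 1, q + int s)"
      using step(1) by (simp add: src.diff_deg_Suc_eq)
    have "subquot_inj 1 s (p - int s - 1, q + int s)" using step q by simp
    then have "subquot_inj s s (p - int s - 1, q + int s)" using step(1) by (rule subquot_inj_mono_cycles)
    moreover have "subquot_surj s 1 (p, q)" using step q by simp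
    ultimately show "subquot_surj (Suc s) 1 (p, q)"
      using subquot_surj_Suc[of s 1 "(p, q)"] t by simp
  qed
qed

lemma subquot_injD: "iso_upto n \<Longrightarrow> s \<ge> 1 \<Longrightarrow> q \<le> n \<Longrightarrow> subquot_inj s s (p, q)"
  using pages_inj_surj[of n s] subquot_inj_mono_cycles[of 1 s "(p, q)" s] by blast

lemma subquot_surjD: "iso_upto n \<Longrightarrow> s \<ge> 1 \<Longrightarrow> q + int s \<le> n + 1 \<Longrightarrow> subquot_surj s s (p, q)"
  using pages_inj_surj[of n s] subquot_surj_mono_boundaries[of s 1 "(p, q)" s] by blast

lemma abutment_map_coset:
  assumes s: "s \<ge> 1" "q < int s" and pq: "p + q \<ge> 0" and u: "u \<in> filt C1 (p, q)"
    and z: "z \<in> Zsub C1 s (p, q)" "\<pi>1 (p, q) u = Bsub C1 s (p, q) +>\<^bsub>Emod C1 (p, q)\<^esub> z"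
  shows "\<pi>2 (p, q) (colim_map C2 f u) = Bsub C2 s (p, q) +>\<^bsub>Emod C2 (p, q)\<^esub> g (p, q) z"
proof -
  have "z \<in> carrier (Emod C1 (p, q))" using z(1) src.Zsub_subset[of s "(p, q)"] by blast
  from page_map_coset[OF this, of s]
  have "page_inf_map C1 C2 g (p, q) (\<pi>1 (p, q) u) = Bsub C2 s (p, q) +>\<^bsub>Emod C2 (p, q)\<^esub> g (p, q) z"
    by (simp add: z(2) page_inf_map_def page_map_def tgt.Union_Bsub[OF s])
  moreover have "\<pi>2 (p, q) (colim_map C2 f u) = page_inf_map C1 C2 g (p, q) (\<pi>1 (p, q) u)"
    using compatible pq u unfolding matchings_compatible_def by blast
  ultimately show ?thesis by simp
qed

lemma page_inf_coset:
  assumes s: "s \<ge> 1" "p \<le> int s" "q < int s" and pq: "p + q \<ge> 0" and u: "u \<in> filt C1 (p, q)"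
  shows "\<exists>z\<in>Zsub C1 s (p, q). \<pi>1 (p, q) u = Bsub C1 s (p, q) +>\<^bsub>Emod C1 (p, q)\<^esub> z \<and>
    \<pi>2 (p, q) (colim_map C2 f u) = Bsub C2 s (p, q) +>\<^bsub>Emod C2 (p, q)\<^esub> g (p, q) z"
proof -
  have "\<pi>1 (p, q) u \<in> carrier (page C1 (Suc s) (p, q))"
    using \<pi>_closed[OF matching1 pq u] by (simp add: src.page_inf_eq[OF s])
  then show ?thesis
    unfolding src.carrier_page_Suc using abutment_map_coset[OF s(1,3) pq u] by blast
qed

lemma page_inf_zero: 
  assumes "s \<ge> 1" "p \<le> int s" "q < int s"
  shows "\<zero>\<^bsub>page_inf C1 (p, q)\<^esub> = Bsub C1 s (p, q)" "\<zero>\<^bsub>page_inf C2 (p, q)\<^esub> = Bsub C2 s (p, q)"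
  using assms by (simp_all add: src.page_inf_eq tgt.page_inf_eq src.page_Suc tgt.page_Suc zero_quot_module)

text \<open>Descent along the filtration from \<open>F\<^sub>m\<^sub>,\<^sub>0\<close>, the whole abutment. An element of a smaller stage comes from
an element \<open>u1\<close> of the stage before. Its class in \<open>E\<^sup>\<infinity>\<close> is mapped to zero, hence is zero by
injectivity, so \<open>u1\<close> already lies in the smaller stage. Only rows up to \<open>n\<close> are crossed on the way
to the row \<open>n + 1\<close>.\<close>

lemma filt_surj:
  assumes "iso_upto n" "m \<ge> 0" "int k \<le> n + 1"
  shows "filt C2 (m - int k, int k) \<subseteq> colim_map C2 f ` filt C1 (m - int k, int k)"
  using assms(3)
proof (induction k)
  case 0
  show ?case
    using abutment_iso[of m] matches_abutment_ends(2)[OF matching1 assms(2)]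
      matches_abutment_ends(2)[OF matching2 assms(2)]
    by (simp add: lin_iso_def bij_betw_def)
next
  case (Suc k)
  let ?p = "m - int k"
  \<comment> \<open>A page on which both the cycles and the boundaries at this position are stable.\<close>
  define s where "s = Suc (nat m + k)"
  have s: "s \<ge> 1" "?p \<le> int s" "int k < int s" and pq: "?p + int k \<ge> 0"
    using assms(2) by (auto simp: s_def)
  have next_eq: "(m - int (Suc k), int (Suc k)) = (?p - 1, int k + 1)" by simp
  show ?case unfolding next_eq
  proof
    fix u2 assume u2: "u2 \<in> filt C2 (?p - 1, int k + 1)"
    then have "u2 \<in> filt C2 (?p, int k)" using filt_mono[OF matching2 pq] by blast
    then obtain u1 where u1: "u1 \<in> filt C1 (?p, int k)" "u2 = colim_map C2 f u1"
      using Suc by auto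
    obtain z where z: "z \<in> Zsub C1 s (?p, int k)"
      "\<pi>1 (?p, int k) u1 = Bsub C1 s (?p, int k) +>\<^bsub>Emod C1 (?p, int k)\<^esub> z"
      "\<pi>2 (?p, int k) u2 = Bsub C2 s (?p, int k) +>\<^bsub>Emod C2 (?p, int k)\<^esub> g (?p, int k) z"
      using page_inf_coset[OF s pq u1(1)] unfolding u1(2) by blast
    have zc: "z \<in> carrier (Emod C1 (?p, int k))" using z(1) src.Zsub_subset[of s "(?p, int k)"] by blast
    have "\<pi>2 (?p, int k) u2 = Bsub C2 s (?p, int k)"
      using \<pi>_zero_iff[OF matching2 pq] u2 filt_mono[OF matching2 pq] page_inf_zero[OF s] by blast
    then have "g (?p, int k) z \<in> Bsub C2 s (?p, int k)"
      using z(3) left_module.coset_eq_self_iff[OF tgt.E_module tgt.Bsub_submodule g_closed[OF zc]] by simp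
    moreover have "subquot_inj s s (?p, int k)" using subquot_injD[OF assms(1) s(1)] Suc.prems by simp
    ultimately have "z \<in> Bsub C1 s (?p, int k)" using z(1) unfolding subquot_inj_def by blast
    then have "\<pi>1 (?p, int k) u1 = \<zero>\<^bsub>page_inf C1 (?p, int k)\<^esub>"
      using z(2) left_module.coset_eq_self_iff[OF src.E_module src.Bsub_submodule zc] page_inf_zero[OF s] by simp
    then show "u2 \<in> colim_map C2 f ` filt C1 (?p - 1, int k + 1)"
      using \<pi>_zero_iff[OF matching1 pq u1(1)] u1(2) by blast
  qed
qed

lemma page_inf_surj:
  assumes "iso_upto n" "p + q \<ge> 0" "0 \<le> q" "q \<le> n + 1" and s: "s \<ge> 1" "p \<le> int s" "q < int s"
  shows "subquot_surj s s (p, q)"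
  unfolding subquot_surj_def
proof
  fix z' assume z': "z' \<in> Zsub C2 s (p, q)"
  then have "Bsub C2 s (p, q) +>\<^bsub>Emod C2 (p, q)\<^esub> z' \<in> carrier (page_inf C2 (p, q))"
    by (simp add: tgt.page_inf_eq[OF s] tgt.carrier_page_Suc)
  then obtain u2 where u2: "u2 \<in> filt C2 (p, q)"
    "Bsub C2 s (p, q) +>\<^bsub>Emod C2 (p, q)\<^esub> z' = \<pi>2 (p, q) u2"
    using \<pi>_onto[OF matching2 assms(2)] by blast
  have "p + q - int (nat q) = p" "int (nat q) = q" using assms(3) by simp_all
  with filt_surj[OF assms(1,2), of "nat q"] assms(4)
  have "filt C2 (p, q) \<subseteq> colim_map C2 f ` filt C1 (p, q)" by simp
  then obtain u1 where u1: "u1 \<in> filt C1 (p, q)" "u2 = colim_map C2 f u1" using u2(1) by blast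
  obtain z where z: "z \<in> Zsub C1 s (p, q)"
    "\<pi>2 (p, q) u2 = Bsub C2 s (p, q) +>\<^bsub>Emod C2 (p, q)\<^esub> g (p, q) z"
    using page_inf_coset[OF s assms(2) u1(1)] unfolding u1(2) by blast
  have "z' \<in> carrier (Emod C2 (p, q))" "g (p, q) z \<in> carrier (Emod C2 (p, q))"
    using z' z(1) src.Zsub_subset[of s "(p, q)"] tgt.Zsub_subset[of s "(p, q)"] g_closed[of z "(p, q)"]
    by blast+
  from iffD1[OF left_module.coset_eq_iff[OF tgt.E_module tgt.Bsub_submodule this] trans[OF u2(2) z(2)]]
  have "z' \<ominus>\<^bsub>Emod C2 (p, q)\<^esub> g (p, q) z \<in> Bsub C2 s (p, q)" .
  with z(1) show "\<exists>z\<in>Zsub C1 s (p, q). z' \<ominus>\<^bsub>Emod C2 (p, q)\<^esub> g (p, q) z \<in> Bsub C2 s (p, q)" by blast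
qed

text \<open>As \<open>F\<^sub>-\<^sub>1\<^sub>,\<^sub>q\<^sub>+\<^sub>1 = 0\<close>, the projection from \<open>F\<^sub>0\<^sub>,\<^sub>q\<close> to \<open>E\<^sup>\<infinity>\<^sub>0\<^sub>,\<^sub>q\<close> is injective; so injectivity is inherited from
the map of the abutments.\<close>

lemma page_inf_edge_inj:
  assumes q: "q \<ge> 0" and s: "q < int s"
  shows "subquot_inj s s (0, q)"
  unfolding subquot_inj_def
proof (intro ballI impI)
  fix z assume z: "z \<in> Zsub C1 s (0, q)" and gz: "g (0, q) z \<in> Bsub C2 s (0, q)"
  have s': "s \<ge> 1" "0 \<le> int s" "q < int s" and pq: "0 + q \<ge> 0" using q s by auto
  have zc: "z \<in> carrier (Emod C1 (0, q))" using z src.Zsub_subset[of s "(0, q)"] by blast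
  note F = matches_abutment_ends(1)[OF matching1 q] matches_abutment_ends(1)[OF matching2 q]
  have "Bsub C1 s (0, q) +>\<^bsub>Emod C1 (0, q)\<^esub> z \<in> carrier (page_inf C1 (0, q))"
    using z by (simp add: src.page_inf_eq[OF s'] src.carrier_page_Suc)
  then obtain u where u: "u \<in> filt C1 (0, q)" "Bsub C1 s (0, q) +>\<^bsub>Emod C1 (0, q)\<^esub> z = \<pi>1 (0, q) u"
    using \<pi>_onto[OF matching1 pq] by blast
  have "\<pi>2 (0, q) (colim_map C2 f u) = Bsub C2 s (0, q)"
    using abutment_map_coset[OF s'(1,3) pq u(1) z u(2)[symmetric]] gz
      left_module.coset_eq_self_iff[OF tgt.E_module tgt.Bsub_submodule g_closed[OF zc]] by simp
  then have "colim_map C2 f u \<in> filt C2 (0 - 1, q + 1)"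
    using \<pi>_zero_iff[OF matching2 pq colim_map_filt[OF u(1)]] unfolding page_inf_zero(2)[OF s'] by simp
  then have "colim_map C2 f u = \<zero>\<^bsub>colim C2 q\<^esub>" using F(2) by simp
  moreover have "colim_map C2 f \<zero>\<^bsub>colim C1 q\<^esub> = \<zero>\<^bsub>colim C2 q\<^esub>"
    using colim_map_filt[of "\<zero>\<^bsub>colim C1 q\<^esub>" "(-1, q + 1)"] F by simp
  moreover have "inj_on (colim_map C2 f) (carrier (colim C1 q))"
    using abutment_iso[of q] by (simp add: lin_iso_def bij_betw_def)
  moreover have "u \<in> carrier (colim C1 q)" "\<zero>\<^bsub>colim C1 q\<^esub> \<in> carrier (colim C1 q)"
    using u(1) src.filt_subset_colim[of 0 q] src.filt_subset_colim[of "-1" "q + 1"] F(1) by auto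
  ultimately have "u = \<zero>\<^bsub>colim C1 q\<^esub>" by (simp add: inj_on_def)
  then have "\<pi>1 (0, q) u = Bsub C1 s (0, q)"
    using \<pi>_zero_iff[OF matching1 pq u(1)] F(1) unfolding page_inf_zero(1)[OF s'] by simp
  then show "z \<in> Bsub C1 s (0, q)"
    using u(2) left_module.coset_eq_self_iff[OF src.E_module src.Bsub_submodule zc] by simp
qed

text \<open>The sources of the differentials into a row \<open>q \<le> n + 1\<close> lie in rows where the map is known to be
surjective on the page in question.\<close>

lemma surj_down:
  assumes "iso_upto n" "q \<le> n + 1" "1 \<le> t" "t \<le> s" "subquot_surj a s (p, q)"
  shows "subquot_surj a t (p, q)"
  using assms(4)
proof (induction rule: inc_induct)
  case base
  then show ?case by (rule assms(5))
next
  case (step u)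
  then have u: "u \<ge> 1" using assms(3) by simp
  have "subquot_surj u u (p + int u + 1, q - int u)"
    using assms(2) by (intro subquot_surjD[OF assms(1) u]) simp
  then show ?case
    using subquot_surj_boundaries_down[of a u "(p + int u + 1, q - int u)"] step source_eq[OF u] by simp
qed

lemma subquot_surj_stable:
  assumes "1 \<le> t" "p \<le> int t" "t \<le> s" "subquot_surj s b (p, q)"
  shows "subquot_surj t b (p, q)"
  using assms(4) src.Zsub_stable[OF assms(1-3), of q] tgt.Zsub_stable[OF assms(1-3), of q]
  by (simp add: subquot_surj_def)

text \<open>The kernel of the differential into \<open>(0, n + 1)\<close> on page \<open>t + 1\<close>. Its cycles are permanent, since later
differentials leave the quadrant; so it differs from \<open>E\<^sup>\<infinity>\<close> by boundaries alone, and surjectivity on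
\<open>E\<^sup>\<infinity>\<close> descends.\<close>

lemma kernel_surj:
  assumes "iso_upto n" "n \<ge> 0" "t \<ge> 1"
  shows "subquot_surj (Suc t) t (int t + 1, n + 1 - int t)"
proof (cases "n + 1 - int t < 0")
  case True
  then show ?thesis using assms(3) by (intro subquot_surj_vanishing) auto
next
  case False
  define s where "s = t + nat n + 2"
  have "subquot_surj s s (int t + 1, n + 1 - int t)"
    using assms False by (intro page_inf_surj[OF assms(1)]) (auto simp: s_def)
  then have "subquot_surj (Suc t) s (int t + 1, n + 1 - int t)"
    using assms(3) by (intro subquot_surj_stable[of "Suc t" _ s]) (auto simp: s_def)
  then show ?thesis
    using assms(3) by (intro surj_down[OF assms(1), of _ t s]) (auto simp: s_def)
qed

text \<open>In column zero everything is a cycle on all pages from \<open>E\<^sup>2\<close> on, and one passes from \<open>E\<^sup>\<infinity>\<close> back to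
\<open>E\<^sup>2\<close> by lowering the index of the boundaries.\<close>

lemma edge_iso:
  assumes "iso_upto n" "n \<ge> 0"
  shows "subquot_inj 1 1 (0, n + 1) \<and> subquot_surj 1 1 (0, n + 1)"
proof
  define s where "s = nat n + 2"
  have s: "1 \<le> s" "n + 1 < int s" using assms(2) by (auto simp: s_def)
  have "subquot_surj s s (0, n + 1)"
    using assms s by (intro page_inf_surj[OF assms(1)]) auto
  then have "subquot_surj 1 s (0, n + 1)"
    using s by (intro subquot_surj_stable[of 1 _ s]) auto
  then show "subquot_surj 1 1 (0, n + 1)"
    by (intro surj_down[OF assms(1) _ _ s(1)]) auto
  have "subquot_inj s s (0, n + 1)" by (rule page_inf_edge_inj) (use assms(2) s in auto)
  then have start: "subquot_inj 1 s (0, n + 1)"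
    using src.Zsub_stable[of 1 0 s "n + 1"] s by (simp add: subquot_inj_def)
  have "subquot_inj 1 t (0, n + 1)" if "1 \<le> t" "t \<le> s" for t
    using that(2,1)
  proof (induction rule: inc_induct)
    case base
    show ?case by (rule start)
  next
    case (step t)
    then have t: "t \<ge> 1" by simp
    have "subquot_inj t t (int t + 1, n + 1 - int t)"
      using t by (intro subquot_injD[OF assms(1)]) auto
    then show ?case
      using subquot_inj_boundaries_down[of 1 t "(int t + 1, n + 1 - int t)"] step
        kernel_surj[OF assms t] source_eq[OF t, of 0 "n + 1"] by simp
  qed
  from this[of 1] show "subquot_inj 1 1 (0, n + 1)" using s(1) by simp
qed

text \<open>Once all rows of \<open>E\<^sup>2\<close> are known, the bound on \<open>q + s\<close> in the surjectivity statement is void.\<close>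

lemma iso_all_pages:
  assumes "\<And>n. iso_upto n" "r \<ge> 2"
  shows "page_map C1 C2 g r x \<in> lin_iso R (page C1 r x) (page C2 r x)"
proof -
  obtain s where s: "r = Suc s" "s \<ge> 1" using assms(2) by (cases r) auto
  obtain p q where x: "x = (p, q)" by (cases x)
  have "subquot_inj s s (p, q)" "subquot_surj s s (p, q)"
    using subquot_injD[OF assms(1), of s q q p] subquot_surjD[OF assms(1), of s q "q + int s" p] s(2) by auto
  then show ?thesis by (simp add: s(1) x page_map_iso_iff)
qed

end

theorem theorem2p6p5:
  fixes R :: "('r, 'q) ring_scheme"
    and C1 :: "('r, 'd1, 'e1) couple"
    and C2 :: "('r, 'd2, 'e2) couple"
    and f :: "int \<times> int \<Rightarrow> 'd1 \<Rightarrow> 'd2"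
    and g :: "int \<times> int \<Rightarrow> 'e1 \<Rightarrow> 'e2"
    and \<pi>1 :: "int \<times> int \<Rightarrow> ((int \<times> int) \<times> 'd1) set \<Rightarrow> 'e1 set"
    and \<pi>2 :: "int \<times> int \<Rightarrow> ((int \<times> int) \<times> 'd2) set \<Rightarrow> 'e2 set"
  assumes "exact_couple R C1" and "exact_couple R C2"
    and "couple_morphism R C1 C2 f g"
    and first_quadrant1: "\<And>r p q. r \<ge> 2 \<Longrightarrow> p < 0 \<or> q < 0 \<Longrightarrow> zero_module (page C1 r (p, q))"
    and first_quadrant2: "\<And>r p q. r \<ge> 2 \<Longrightarrow> p < 0 \<or> q < 0 \<Longrightarrow> zero_module (page C2 r (p, q))"
    and bidegree1: "\<And>r. r \<ge> 2 \<Longrightarrow> diff_deg C1 r = (- int r, int r - 1)"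
    and bidegree2: "\<And>r. r \<ge> 2 \<Longrightarrow> diff_deg C2 r = (- int r, int r - 1)"
    and matching1: "matches_abutment R C1 \<pi>1"
    and matching2: "matches_abutment R C2 \<pi>2"
    and compatible: "matchings_compatible C1 C2 f g \<pi>1 \<pi>2"
    and abutment_iso: "\<And>n. colim_map C2 f \<in> lin_iso R (colim C1 n) (colim C2 n)"
    and corner_iso: "page_map C1 C2 g 2 (0, 0) \<in> lin_iso R (page C1 2 (0, 0)) (page C2 2 (0, 0))"
    and propagation: "\<And>n :: int. n \<ge> 0 \<Longrightarrow>
       (\<forall>q. 0 \<le> q \<and> q \<le> n \<longrightarrow>
          page_map C1 C2 g 2 (0, q) \<in> lin_iso R (page C1 2 (0, q)) (page C2 2 (0, q))) \<Longrightarrow>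
       (\<forall>p q. q \<le> n \<longrightarrow>
          page_map C1 C2 g 2 (p, q) \<in> lin_iso R (page C1 2 (p, q)) (page C2 2 (p, q)))"
  shows "ss_isomorphism R C1 C2 2 (page_map C1 C2 g)"
proof -
  interpret C1: first_quadrant_couple R C1
    by (intro first_quadrant_couple.intro first_quadrant_couple_axioms.intro assms(1))
      (fact first_quadrant1 bidegree1)+
  interpret C2: first_quadrant_couple R C2
    by (intro first_quadrant_couple.intro first_quadrant_couple_axioms.intro assms(2))
      (fact first_quadrant2 bidegree2)+
  interpret couple_map R C1 C2 f g
    by (intro couple_map.intro couple_map_axioms.intro assms(1-3))
  interpret abutment_comparison R C1 C2 f g \<pi>1 \<pi>2
    by (unfold_locales) (fact matching1 matching2 compatible abutment_iso)+
  have iso2: "page_map C1 C2 g 2 x \<in> lin_iso R (page C1 2 x) (page C2 2 x) \<longleftrightarrow> subquot_inj 1 1 x \<and> subquot_surj 1 1 x" for x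
    using page_map_iso_iff[of 1 x] unfolding Suc_1 .
  have rows: "iso_upto n" if "n \<ge> 0" "\<And>q. 0 \<le> q \<Longrightarrow> q \<le> n \<Longrightarrow> subquot_inj 1 1 (0, q) \<and> subquot_surj 1 1 (0, q)" for n
    using propagation[OF that(1), unfolded iso2] that(2) by blast
  have upto: "iso_upto (int n)" for n
  proof (induction n)
    case 0
    show ?case
    proof (rule rows)
      fix q :: int assume "0 \<le> q" "q \<le> int 0"
      then have "q = 0" by simp
      then show "subquot_inj 1 1 (0, q) \<and> subquot_surj 1 1 (0, q)" using corner_iso unfolding iso2 by simp
    qed simp
  next
    case (Suc n)
    show ?case
    proof (rule rows)
      fix q :: int assume q: "0 \<le> q" "q \<le> int (Suc n)"
      show "subquot_inj 1 1 (0, q) \<and> subquot_surj 1 1 (0, q)"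
      proof (cases "q = int n + 1")
        case True
        then show ?thesis using edge_iso[OF Suc] by simp
      next
        case False
        then show ?thesis using Suc q by simp
      qed
    qed simp
  qed
  have "iso_upto n" for n using upto[of "nat n"] by simp
  then have "page_map C1 C2 g r x \<in> lin_iso R (page C1 r x) (page C2 r x)" if "r \<ge> 2" for r x
    using that by (rule iso_all_pages)
  moreover have "ss_morphism R C1 C2 2 (page_map C1 C2 g)"
    using page_map_ss_morphism[of 1] unfolding Suc_1 .
  ultimately show ?thesis by (simp add: ss_isomorphism_def)
qed


end
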